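(* Let $X_1$ and $X_2$ be Hilbert spaces, let the linear operator $A_{ext}=\begin{bmatrix}A_1\\ A_2\end{bmatrix}:\begin{bmatrix}X_1\\ X_2\end{bmatrix}\supset\mathrm{dom}(A_{ext})\to\begin{bmatrix}X_1\\ X_2\end{bmatrix}$ generate a contraction semigroup on $\begin{bmatrix}X_1\\ X_2\end{bmatrix}$, and let $S$ be a linear operator on $X_2$ such that $-S$ generates a contraction semigroup on $X_2$. Then the following claims are true: 1. The external Cayley system transform $\begin{bmatrix}A\&B\\ C\&D\end{bmatrix}$ of $A_{ext}$ is a scattering-passive system node (with state space $X_1$ and input and output space $X_2$). 2. If the Cayley transform $K=(S-I)(S+I)^{-1}$ of $S$ is an admissible static output feedback operator for $\begin{bmatrix}A\&B\\ C\&D\end{bmatrix}$, then the relation $A_S$ on $X_1$ defined via $$A_Sx:=z,\qquad \begin{bmatrix}z\\ f\end{bmatrix}=A_{ext}\begin{bmatrix}x\\ Sf\end{bmatrix}\ \text{ for some } f\in X_2$$ (i.e. $(x,z)\in A_S$ if and only if there exists $f\in\mathrm{dom}(S)$ with $\begin{bmatrix}x\\ Sf\end{bmatrix}\in\mathrm{dom}(A_{ext})$ and $A_{ext}\begin{bmatrix}x\\ Sf\end{bmatrix}=\begin{bmatrix}z\\ f\end{bmatrix}$) is the (single-valued) generator of a contraction semigroup on $X_1$. 3. If $S$ is bounded (and defined on all of $X_2$) and there exists $\delta>0$ with $\mathrm{Re}\,\langle Sx,x\rangle\geq\delta\|x\|^2$ for all $x\in X_2$, then $K$ is an admissible static output feedback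 operator for $\begin{bmatrix}A\&B\\ C\&D\end{bmatrix}$.
   Context: All Hilbert spaces are complex; $\begin{bmatrix}X_1\\ X_2\end{bmatrix}$ denotes the Hilbert space product, written as columns; operators are linear and in general unbounded. A contraction semigroup is a strongly continuous semigroup ($C_0$-semigroup) of contractions. External Cayley system transform of $A_{ext}$: the operator from a subspace of $\begin{bmatrix}X_1\\ X_2\end{bmatrix}$ into $\begin{bmatrix}X_1\\ X_2\end{bmatrix}$ given by $$\begin{bmatrix}A\&B\\ C\&D\end{bmatrix}:\begin{bmatrix}x\\(e-f)/\sqrt2\end{bmatrix}\mapsto\begin{bmatrix}z\\(e+f)/\sqrt2\end{bmatrix},\qquad \begin{bmatrix}z\\ f\end{bmatrix}=A_{ext}\begin{bmatrix}x\\ e\end{bmatrix},$$ with domain $\left\{\begin{bmatrix}x\\(e-f)/\sqrt2\end{bmatrix} : \begin{bmatrix}x\\ e\end{bmatrix}\in\mathrm{dom}(A_{ext}),\ f=A_2\begin{bmatrix}x\\ e\end{bmatrix}\right\}$. System node: a system node with input space $U$, state space $X$ and output space $Y$ (Hilbert spaces) is a linear operator $\Sigma=\begin{bmatrix}A\&B\\ C\&D\end{bmatrix}:\begin{bmatrix}X\\ U\end{bmatrix}\supset\mathrm{dom}(\Sigma)\to\begin{bmatrix}X\\ Y\end{bmatrix}$ such that: (i) $\Sigma$ is closed; (ii) $A\&B$, the $X$-component of $\Sigma$ (with domain $\mathrm{dom}(\Sigma)$), is closed; (iii) the main operator $A$, defined by $Ax=A\&B\begin{bmatrix}x\\0\end{bmatrix}$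 on $\mathrm{dom}(A)=\{x\in X:\begin{bmatrix}x\\0\end{bmatrix}\in\mathrm{dom}(\Sigma)\}$, generates a $C_0$-semigroup on $X$; (iv) for every $u\in U$ there is $x\in X$ with $\begin{bmatrix}x\\ u\end{bmatrix}\in\mathrm{dom}(\Sigma)$. $C\&D$ denotes the $Y$-component of $\Sigma$. Classical trajectory of $\Sigma$: a triple $(u,x,y)$ with $u\in C([0,\infty);U)$, $x\in C^1([0,\infty);X)$, $y\in C([0,\infty);Y)$, $\begin{bmatrix}x(t)\\ u(t)\end{bmatrix}\in\mathrm{dom}(\Sigma)$ and $\begin{bmatrix}\dot x(t)\\ y(t)\end{bmatrix}=\Sigma\begin{bmatrix}x(t)\\ u(t)\end{bmatrix}$ for all $t\ge0$ (right derivative at $0$). Scattering passive: a system node is (scattering) passive if for all $T\ge0$ and all classical trajectories $(u,x,y)$, $\|x(T)\|_X^2+\int_0^T\|y(t)\|_Y^2\,dt\le\|x(0)\|_X^2+\int_0^T\|u(t)\|_U^2\,dt$. It is known that this is equivalent to: $2\,\mathrm{Re}\,\langle z,x\rangle_X\le\|u\|_U^2-\|y\|_Y^2$ for all $\begin{bmatrix}x\\ u\end{bmatrix}\in\mathrm{dom}(\Sigma)$, where $\begin{bmatrix}z\\ y\end{bmatrix}=\Sigma\begin{bmatrix}x\\ u\end{bmatrix}$. Admissible static output feedback operator: a bounded linear operator $K:Y\to U$ is an admissible static output feedback operator for a system node $\Sigma=\begin{bmatrix}A\&B\\ C\&D\end{bmatrix}$ if there exists another system node $\Sigma^f=\begin{bmatrix}A^f\&B^f\\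 C^f\&D^f\end{bmatrix}$ with the same input, state and output spaces such that: (1) the operator $M:=\begin{bmatrix}I&0\\0&I\end{bmatrix}-\begin{bmatrix}\begin{bmatrix}0&0\end{bmatrix}\\ K[C\&D]\end{bmatrix}$ (i.e. $M\begin{bmatrix}x\\ u\end{bmatrix}=\begin{bmatrix}x\\ u-K[C\&D]\begin{bmatrix}x\\ u\end{bmatrix}\end{bmatrix}$) maps $\mathrm{dom}(\Sigma)$ continuously into $\mathrm{dom}(\Sigma^f)$ (graph norms); (2) $M$ is invertible with $M^{-1}=\begin{bmatrix}I&0\\0&I\end{bmatrix}+\begin{bmatrix}\begin{bmatrix}0&0\end{bmatrix}\\ K[C^f\&D^f]\end{bmatrix}$; (3) $\Sigma^f=\Sigma M^{-1}$. *)

theory Defs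
  imports "HOL-Analysis.Analysis"
begin

class complex_hilbert_space = banach +
  fixes scaleC :: "complex \<Rightarrow> 'a \<Rightarrow> 'a" (infixr "*\<^sub>C" 75)
    and cinner :: "'a \<Rightarrow> 'a \<Rightarrow> complex"
  assumes scaleC_add_right: "a *\<^sub>C (x + y) = a *\<^sub>C x + a *\<^sub>C y"
    and scaleC_add_left: "(a + b) *\<^sub>C x = a *\<^sub>C x + b *\<^sub>C x"
    and scaleC_scaleC: "a *\<^sub>C (b *\<^sub>C x) = (a * b) *\<^sub>C x"
    and scaleC_of_real: "complex_of_real r *\<^sub>C x = r *\<^sub>R x"
    and cinner_commute: "cinner x y = cnj (cinner y x)"
    and cinner_add_left: "cinner (x + y) z = cinner x z + cinner y z"
    and cinner_scaleC_left: "cinner (a *\<^sub>C x) y = a * cinner x y"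
    and norm_eq_cinner: "complex_of_real ((norm x)\<^sup>2) = cinner x x"

interpretation complex_vector:
  vector_space "scaleC :: complex \<Rightarrow> 'a \<Rightarrow> 'a::complex_hilbert_space"
proof
  show "1 *\<^sub>C x = x" for x :: 'a
    using scaleC_of_real[of 1 x] by simp
qed (simp_all add: scaleC_add_right scaleC_add_left scaleC_scaleC)

instantiation complex :: complex_hilbert_space
begin
definition "scaleC = ((*) :: complex \<Rightarrow> complex \<Rightarrow> complex)"
definition "cinner x y = x * cnj (y :: complex)"
instance
proof
  show "complex_of_real ((norm x)\<^sup>2) = cinner x x" for x :: complex
    by (simp only: cinner_complex_def complex_norm_square)
qed (simp_all add: scaleC_complex_def cinner_complex_def algebra_simps scaleR_conv_of_real)
end

text \<open>The library norm on a product type is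
  \<open>norm (x, y) = sqrt ((norm x)\<^sup>2 + (norm y)\<^sup>2)\<close>, so this is the Hilbert space product.\<close>

instantiation prod :: (complex_hilbert_space, complex_hilbert_space) complex_hilbert_space
begin
definition "scaleC c p = (c *\<^sub>C fst p, c *\<^sub>C snd p)"
definition "cinner p q = cinner (fst p) (fst q) + cinner (snd p) (snd q)"
instance
proof
  show "cinner x y = cnj (cinner y x)" for x y :: "'a \<times> 'b"
    by (simp add: cinner_prod_def cinner_commute[of "fst x"] cinner_commute[of "snd x"])
  show "complex_of_real ((norm x)\<^sup>2) = cinner x x" for x :: "'a \<times> 'b"
    by (simp add: norm_prod_def cinner_prod_def flip: norm_eq_cinner)
qed (auto simp: scaleC_prod_def cinner_prod_def scaleC_add_right scaleC_add_left scaleC_scaleC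
       scaleC_of_real cinner_add_left cinner_scaleC_left prod_eq_iff algebra_simps)
end

text \<open>An operator (or linear relation) is identified with its graph: \<open>(x, z) \<in> A\<close> means that
  \<open>x\<close> is in the domain and \<open>z\<close> is a value at \<open>x\<close>. Hence \<open>Domain A\<close> is the domain, \<open>A\<inverse>\<close> the inverse,
  and \<open>closed A\<close> says that the operator is closed. Note that \<open>A O B\<close> is the operator product \<open>BA\<close>
  (\<open>A\<close> acts first).\<close>

type_synonym ('a, 'b) operator = "('a \<times> 'b) set"

definition linear_operator ::
    "('a::complex_hilbert_space, 'b::complex_hilbert_space) operator \<Rightarrow> bool" where
  "linear_operator A \<longleftrightarrow> single_valued A \<and> complex_vector.subspace A"

definition bounded_operator ::
    "('a::complex_hilbert_space, 'b::complex_hilbert_space) operator \<Rightarrow> bool" where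
  "bounded_operator A \<longleftrightarrow> linear_operator A \<and> Domain A = UNIV \<and>
     (\<exists>c. \<forall>(x, z) \<in> A. norm z \<le> c * norm x)"

definition neg_operator :: "('a, 'b::uminus) operator \<Rightarrow> ('a, 'b) operator" where
  "neg_operator A = {(x, - z) | x z. (x, z) \<in> A}"

text \<open>Only the values \<open>T t\<close> with \<open>t \<ge> 0\<close> are relevant.\<close>

definition C0_semigroup :: "(real \<Rightarrow> 'a \<Rightarrow> 'a::complex_hilbert_space) \<Rightarrow> bool" where
  "C0_semigroup T \<longleftrightarrow>
     (\<forall>t\<ge>0. bounded_linear (T t) \<and> Vector_Spaces.linear scaleC scaleC (T t)) \<and>
     T 0 = id \<and>
     (\<forall>s\<ge>0. \<forall>t\<ge>0. T (s + t) = T s \<circ> T t) \<and>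
     (\<forall>x. continuous_on {0..} (\<lambda>t. T t x))"

definition contraction_semigroup :: "(real \<Rightarrow> 'a \<Rightarrow> 'a::complex_hilbert_space) \<Rightarrow> bool" where
  "contraction_semigroup T \<longleftrightarrow> C0_semigroup T \<and> (\<forall>t\<ge>0. \<forall>x. norm (T t x) \<le> norm x)"

definition semigroup_generator ::
    "(real \<Rightarrow> 'a \<Rightarrow> 'a::complex_hilbert_space) \<Rightarrow> ('a, 'a) operator" where
  "semigroup_generator T = {(x, z). ((\<lambda>h. (T h x - x) /\<^sub>R h) \<longlongrightarrow> z) (at_right 0)}"

definition generates_C0_semigroup :: "('a::complex_hilbert_space, 'a) operator \<Rightarrow> bool" where
  "generates_C0_semigroup A \<longleftrightarrow> (\<exists>T. C0_semigroup T \<and> A = semigroup_generator T)"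

definition generates_contraction_semigroup ::
    "('a::complex_hilbert_space, 'a) operator \<Rightarrow> bool" where
  "generates_contraction_semigroup A \<longleftrightarrow>
     (\<exists>T. contraction_semigroup T \<and> A = semigroup_generator T)"

text \<open>Input space \<open>'u\<close>, state space \<open>'x\<close>, output space \<open>'y\<close>.\<close>

type_synonym ('u, 'x, 'y) system_operator = "('x \<times> 'u, 'x \<times> 'y) operator"

definition AB :: "('u, 'x, 'y) system_operator \<Rightarrow> ('x \<times> 'u, 'x) operator" where
  "AB \<Sigma> = {(w, z) | w z y. (w, (z, y)) \<in> \<Sigma>}"

definition CD :: "('u, 'x, 'y) system_operator \<Rightarrow> ('x \<times> 'u, 'y) operator" where
  "CD \<Sigma> = {(w, y) | w z y. (w, (z, y)) \<in> \<Sigma>}"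

definition main_operator :: "('u::zero, 'x, 'y) system_operator \<Rightarrow> ('x, 'x) operator" where
  "main_operator \<Sigma> = {(x, z). ((x, 0), z) \<in> AB \<Sigma>}"

definition system_node ::
    "('u::complex_hilbert_space, 'x::complex_hilbert_space, 'y::complex_hilbert_space)
       system_operator \<Rightarrow> bool" where
  "system_node \<Sigma> \<longleftrightarrow>
     linear_operator \<Sigma> \<and>
     closed \<Sigma> \<and>
     closed (AB \<Sigma>) \<and>
     generates_C0_semigroup (main_operator \<Sigma>) \<and>
     (\<forall>u. \<exists>x. (x, u) \<in> Domain \<Sigma>)"

definition classical_trajectory ::
    "('u::complex_hilbert_space, 'x::complex_hilbert_space, 'y::complex_hilbert_space)
       system_operator \<Rightarrow> (real \<Rightarrow> 'u) \<Rightarrow> (real \<Rightarrow> 'x) \<Rightarrow> (real \<Rightarrow> 'y) \<Rightarrow> bool" where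
  "classical_trajectory \<Sigma> u x y \<longleftrightarrow>
     continuous_on {0..} u \<and> continuous_on {0..} y \<and>
     (\<exists>x'. continuous_on {0..} x' \<and>
       (\<forall>t\<ge>0. (x has_vector_derivative x' t) (at t within {0..}) \<and>
              ((x t, u t), (x' t, y t)) \<in> \<Sigma>))"

definition scattering_passive ::
    "('u::complex_hilbert_space, 'x::complex_hilbert_space, 'y::complex_hilbert_space)
       system_operator \<Rightarrow> bool" where
  "scattering_passive \<Sigma> \<longleftrightarrow>
     (\<forall>T\<ge>0. \<forall>u x y. classical_trajectory \<Sigma> u x y \<longrightarrow>
        (norm (x T))\<^sup>2 + integral {0..T} (\<lambda>t. (norm (y t))\<^sup>2)
          \<le> (norm (x 0))\<^sup>2 + integral {0..T} (\<lambda>t. (norm (u t))\<^sup>2))"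

text \<open>\<open>CD \<Sigma> O K\<close> is the operator \<open>K[C&D]\<close>.\<close>

definition feedback_minus ::
    "('y, 'u) operator \<Rightarrow> ('u::minus, 'x, 'y) system_operator \<Rightarrow> ('x \<times> 'u, 'x \<times> 'u) operator" where
  "feedback_minus K \<Sigma> = {((x, u), (x, u - k)) | x u k. ((x, u), k) \<in> CD \<Sigma> O K}"

definition feedback_plus ::
    "('y, 'u) operator \<Rightarrow> ('u::plus, 'x, 'y) system_operator \<Rightarrow> ('x \<times> 'u, 'x \<times> 'u) operator" where
  "feedback_plus K \<Sigma> = {((x, u), (x, u + k)) | x u k. ((x, u), k) \<in> CD \<Sigma> O K}"

text \<open>For \<open>(w, p)\<close> in the graph of \<open>\<Sigma>\<close>, \<open>norm (w, p)\<close> is the graph norm of \<open>w \<in> dom \<Sigma>\<close>.\<close>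

definition admissible_feedback ::
    "('y::complex_hilbert_space, 'u::complex_hilbert_space) operator \<Rightarrow>
     ('u, 'x::complex_hilbert_space, 'y) system_operator \<Rightarrow> bool" where
  "admissible_feedback K \<Sigma> \<longleftrightarrow>
     bounded_operator K \<and>
     (\<exists>\<Sigma>f :: ('u, 'x, 'y) system_operator. system_node \<Sigma>f \<and>
        (let M = feedback_minus K \<Sigma> in
          Range M \<subseteq> Domain \<Sigma>f \<and>
          (\<exists>c. \<forall>w v p q. (w, v) \<in> M \<and> (w, p) \<in> \<Sigma> \<and> (v, q) \<in> \<Sigma>f
                 \<longrightarrow> norm (v, q) \<le> c * norm (w, p)) \<and>
          M\<inverse> = feedback_plus K \<Sigma>f \<and>
          \<Sigma>f = M\<inverse> O \<Sigma>))"

definition external_cayley_system_transform ::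
    "('x1 \<times> 'x2::real_vector, 'x1 \<times> 'x2) operator \<Rightarrow> ('x2, 'x1, 'x2) system_operator" where
  "external_cayley_system_transform Aext =
     {((x, (e - f) /\<^sub>R sqrt 2), (z, (e + f) /\<^sub>R sqrt 2)) | x e z f. ((x, e), (z, f)) \<in> Aext}"

text \<open>\<open>(S - I)(S + I)\<^sup>-\<^sup>1\<close>\<close>

definition cayley_transform :: "('a::ab_group_add, 'a) operator \<Rightarrow> ('a, 'a) operator" where
  "cayley_transform S = {(x, s + x) | x s. (x, s) \<in> S}\<inverse> O {(x, s - x) | x s. (x, s) \<in> S}"

definition A_S :: "('x1 \<times> 'x2, 'x1 \<times> 'x2) operator \<Rightarrow> ('x2, 'x2) operator \<Rightarrow> ('x1, 'x1) operator"
  where "A_S Aext S = {(x, z). \<exists>f s. (f, s) \<in> S \<and> ((x, s), (z, f)) \<in> Aext}"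

end

(* Contraction generators on a Hilbert space are exactly the single-valued dissipative operators A
   with range (I - A) = X. If A is such an operator, the implicit Euler approximations
   (I - 2^-k A)^-floor(2^k t) converge to a contraction semigroup generated by A. Conversely, for a
   contraction semigroup T, the operator exp(-1) T(1) is a strict contraction, so that
   y = x - exp(-1) T(1) x for some x, and the integral of exp(-s) T(s) x over [0, 1] solves
   (I - A) w = y.

   In the coordinates u = (e - f)/sqrt 2, y = (e + f)/sqrt 2, dissipativity of Aext reads
   2 Re <z, x> <= |u|^2 - |y|^2, and solving p - Aext p = (h, sqrt 2 u) means finding, for a given
   input u, a state x with x - z = h. The map from u to y obtained in this way is nonexpansive, so
   that a feedback K with |K| < 1 can be closed by Banach's fixed point theorem. The main operator
   of the closed loop for the Cayley transform of S is A_S, which inherits dissipativity from Aext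
   and -S; a C0-semigroup with dissipative generator is contractive. *)

theory Submission
  imports Defs
begin

section \<open>Dissipative operators and their semigroups\<close>

text \<open>Density of the domain has to be proved: in a Hilbert space it follows from dissipativity
  and the range condition, because the resolvents with step 2^-k turn out to converge strongly to
  the identity. The steps are dyadic because halving a step replaces one resolvent by two, so that
  consecutive approximations can be compared factor by factor. On the domain of the square of A they
  differ by O(2^-k), which is summable, and since all of them are contractions, the limit extends
  from this dense set to the whole space. For both system nodes, with and without feedback, one
  inequality c |y|^2 <= C |u|^2 - 2 Re <z, x> does the analytic work: applied to differences it
  makes A&B closed, at input 0 it makes the main operator dissipative, and at x = 0, u = 0 it forces
  y = 0, which is the heart of single-valuedness. In the closed loop the original system receives v
  + K y, and it is |K| < 1 that leaves a positive multiple of |y|^2 on the left.\<close>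

definition rip :: "'a::complex_hilbert_space \<Rightarrow> 'a \<Rightarrow> real" where
  "rip x y = Re (cinner x y)"

lemma rip_commute: "rip x y = rip y x"
  unfolding rip_def by (subst cinner_commute) simp

lemma rip_add_left: "rip (x + y) z = rip x z + rip y z"
  by (simp add: rip_def cinner_add_left)

lemma rip_add_right: "rip x (y + z) = rip x y + rip x z"
  by (metis rip_add_left rip_commute)

lemma rip_scaleR_left: "rip (r *\<^sub>R x) y = r * rip x y"
  by (simp add: rip_def cinner_scaleC_left flip: scaleC_of_real)

lemma power2_norm_eq_rip: "(norm x)\<^sup>2 = rip x x"
  unfolding rip_def by (metis Re_complex_of_real norm_eq_cinner)

lemma norm_add_squared: "(norm (x + y))\<^sup>2 = (norm x)\<^sup>2 + 2 * rip x y + (norm y)\<^sup>2"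
  for x y :: "'a::complex_hilbert_space"
  by (simp add: power2_norm_eq_rip rip_add_left rip_add_right rip_commute[of y x])

text \<open>The class \<open>banach\<close> already supplies the triangle inequality, and squaring
  it leaves exactly Cauchy-Schwarz for the mixed terms.\<close>

lemma rip_le_norm: "rip x y \<le> norm x * norm y"
proof -
  have "(norm (x + y))\<^sup>2 \<le> (norm x + norm y)\<^sup>2"
    by (intro power_mono norm_triangle_ineq) simp
  then show ?thesis
    by (simp add: norm_add_squared power2_sum)
qed

lemma abs_rip_le_norm: "\<bar>rip x y\<bar> \<le> norm x * norm y"
  using rip_le_norm[of x y] rip_le_norm[of "- x" y] rip_scaleR_left[of "-1" x y] by simp

text \<open>Only real parts enter dissipativity and the energy balance. The real part is symmetric
  and induces the same norm, and this interpretation supplies its limit and product rules.\<close>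

interpretation rip: bounded_bilinear rip
proof
  show "rip x (r *\<^sub>R y) = r *\<^sub>R rip x y" for r and x y :: 'a
    by (metis real_scaleR_def rip_commute rip_scaleR_left)
  show "\<exists>K. \<forall>x y :: 'a. norm (rip x y) \<le> norm x * norm y * K"
    by (intro exI[of _ 1]) (simp add: abs_rip_le_norm)
qed (simp_all add: rip_add_left rip_add_right rip_scaleR_left)

lemma norm_diff_squared: "(norm (x - y))\<^sup>2 = (norm x)\<^sup>2 - 2 * rip x y + (norm y)\<^sup>2"
  for x y :: "'a::complex_hilbert_space"
  using norm_add_squared[of x "- y"] by (simp add: rip.minus_right)

lemma rip_prod: "rip (x, e) (z, f) = rip x z + rip e f"
  by (simp add: rip_def cinner_prod_def)

lemma norm_scaleC: "norm (c *\<^sub>C x) = cmod c * norm x"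
proof -
  have "complex_of_real ((norm (c *\<^sub>C x))\<^sup>2) = c * (cnj c * cinner x x)"
    unfolding norm_eq_cinner cinner_scaleC_left
    by (subst cinner_commute) (simp add: cinner_scaleC_left flip: cinner_commute)
  also have "\<dots> = complex_of_real ((cmod c * norm x)\<^sup>2)"
    using complex_norm_square[of c] by (simp add: power_mult_distrib flip: norm_eq_cinner)
  finally have "(norm (c *\<^sub>C x))\<^sup>2 = (cmod c * norm x)\<^sup>2"
    using of_real_eq_iff by blast
  then show ?thesis
    by (simp add: power2_eq_iff_nonneg)
qed

lemma scaleC_scaleR_commute: "c *\<^sub>C r *\<^sub>R x = r *\<^sub>R c *\<^sub>C x"
  by (metis mult.commute scaleC_of_real scaleC_scaleC)

lemma bounded_linear_scaleC: "bounded_linear (\<lambda>x. c *\<^sub>C x)"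
  by (rule bounded_linear_intro[where K = "cmod c"])
    (simp_all add: scaleC_add_right scaleC_scaleR_commute norm_scaleC)

lemmas tendsto_scaleC = bounded_linear.tendsto[OF bounded_linear_scaleC]

lemma scaleC_diff_right: "c *\<^sub>C (x - y) = c *\<^sub>C x - c *\<^sub>C y"
  by (rule linear_diff[OF bounded_linear.linear[OF bounded_linear_scaleC]])

lemma clinearI:
  assumes "\<And>x y. f (x + y) = f x + f y" and "\<And>c x. f (c *\<^sub>C x) = c *\<^sub>C f x"
  shows "Vector_Spaces.linear scaleC scaleC f"
  by (rule Vector_Spaces.linear.intro)
    (use assms in \<open>auto intro!: complex_vector.vector_space_axioms module_hom.intro
       module_hom_axioms.intro simp: complex_vector.module_axioms\<close>)

lemma clinear_add: "Vector_Spaces.linear scaleC scaleC f \<Longrightarrow> f (x + y) = f x + f y"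
  and clinear_scaleC: "Vector_Spaces.linear scaleC scaleC f \<Longrightarrow> f (c *\<^sub>C x) = c *\<^sub>C f x"
  by (simp_all add: Vector_Spaces.linear_iff)

section \<open>Graphs as complex subspaces\<close>

lemma subspace_scaleR:
  assumes "complex_vector.subspace V" "v \<in> V"
  shows "r *\<^sub>R v \<in> V"
  using complex_vector.subspace_scale[OF assms, of "complex_of_real r"] by (simp add: scaleC_of_real)

lemma operator_add:
  "complex_vector.subspace A \<Longrightarrow> (x, z) \<in> A \<Longrightarrow> (x', z') \<in> A \<Longrightarrow> (x + x', z + z') \<in> A"
  using complex_vector.subspace_add[of A "(x, z)" "(x', z')"] by simp

lemma operator_diff:
  "complex_vector.subspace A \<Longrightarrow> (x, z) \<in> A \<Longrightarrow> (x', z') \<in> A \<Longrightarrow> (x - x', z - z') \<in> A"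
  using complex_vector.subspace_diff[of A "(x, z)" "(x', z')"] by simp

lemma operator_scaleC:
  "complex_vector.subspace A \<Longrightarrow> (x, z) \<in> A \<Longrightarrow> (c *\<^sub>C x, c *\<^sub>C z) \<in> A"
  using complex_vector.subspace_scale[of A "(x, z)" c] by (simp add: scaleC_prod_def)

lemma operator_scaleR:
  "complex_vector.subspace A \<Longrightarrow> (x, z) \<in> A \<Longrightarrow> (r *\<^sub>R x, r *\<^sub>R z) \<in> A"
  using subspace_scaleR[of A "(x, z)" r] by simp

lemma operator_zero: "complex_vector.subspace A \<Longrightarrow> (0, 0) \<in> A"
  using complex_vector.subspace_0[of A] by (simp add: zero_prod_def)

lemma operator_subspaceI:
  assumes "(0, 0) \<in> A"
    and "\<And>x z x' z'. (x, z) \<in> A \<Longrightarrow> (x', z') \<in> A \<Longrightarrow> (x + x', z + z') \<in> A"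
    and "\<And>c x z. (x, z) \<in> A \<Longrightarrow> (c *\<^sub>C x, c *\<^sub>C z) \<in> A"
  shows "complex_vector.subspace A"
  by (rule complex_vector.subspaceI)
    (use assms in \<open>auto simp: zero_prod_def scaleC_prod_def\<close>)

lemma single_valued_operatorI:
  assumes "complex_vector.subspace A" and "\<And>z. (0, z) \<in> A \<Longrightarrow> z = 0"
  shows "single_valued A"
  by (metis assms operator_diff diff_self eq_iff_diff_eq_0 single_valuedI)

section \<open>Maximal dissipative operators and their resolvents\<close>

locale m_dissipative =
  fixes A :: "('a::complex_hilbert_space, 'a) operator"
  assumes subspace: "complex_vector.subspace A"
    and single_valued: "single_valued A"
    and dissipative: "(x, z) \<in> A \<Longrightarrow> rip z x \<le> 0"
    and range_id_minus: "\<exists>x z. (x, z) \<in> A \<and> x - z = y"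
begin

lemmas add = operator_add[OF subspace]
  and diff = operator_diff[OF subspace]
  and scaleC = operator_scaleC[OF subspace]
  and scaleR = operator_scaleR[OF subspace]

lemma unique: "(x, z) \<in> A \<Longrightarrow> (x, z') \<in> A \<Longrightarrow> z = z'"
  using single_valued by (rule single_valuedD)

text \<open>Dissipativity gives the cross term in |x - h z|^2 the right sign. Consequently I - h A
  is injective with a nonexpansive inverse for every h >= 0.\<close>

lemma norm_le_norm_diff:
  assumes "(x, z) \<in> A" "h \<ge> 0"
  shows "norm x \<le> norm (x - h *\<^sub>R z)"
proof (rule power2_le_imp_le)
  have "h * rip x z \<le> 0"
    using dissipative[OF assms(1)] assms(2) by (simp add: rip_commute mult_le_0_iff)
  then show "(norm x)\<^sup>2 \<le> (norm (x - h *\<^sub>R z))\<^sup>2"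
    using zero_le_power2[of "norm (h *\<^sub>R z)"]
    unfolding norm_diff_squared rip.scaleR_right real_scaleR_def by linarith
qed simp

text \<open>The range condition provides a point (w, g) of the graph with the same value of I - A as
  the limit; by the nonexpansive inverse of I - A the sequence of arguments must converge to
  w.\<close>

lemma closed: "closed A"
  unfolding closed_sequential_limits
proof (intro allI impI, elim conjE)
  fix p :: "nat \<Rightarrow> 'a \<times> 'a" and l
  assume p: "\<forall>n. p n \<in> A" and lim: "p \<longlonglongrightarrow> l"
  obtain w g where wg: "(w, g) \<in> A" "w - g = fst l - snd l"
    using range_id_minus by blast
  have "(fst (p n) - w, snd (p n) - g) \<in> A" for n
    using diff p wg(1) by (metis prod.collapse)
  from norm_le_norm_diff[OF this, of 1]
  have le: "norm (fst (p n) - w) \<le> norm (fst (p n) - snd (p n) - (w - g))" for n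
    by (simp add: algebra_simps)
  have "(\<lambda>n. fst (p n) - snd (p n) - (w - g)) \<longlonglongrightarrow> fst l - snd l - (w - g)"
    by (intro tendsto_intros tendsto_fst[OF lim] tendsto_snd[OF lim])
  then have "(\<lambda>n. norm (fst (p n) - snd (p n) - (w - g))) \<longlonglongrightarrow> 0"
    using wg(2) by (simp add: tendsto_norm_zero)
  then have "(\<lambda>n. fst (p n) - w) \<longlonglongrightarrow> 0"
    by (rule Lim_null_comparison[rotated]) (use le in simp)
  then have "fst l = w"
    by (rule LIMSEQ_unique[OF tendsto_fst[OF lim] LIM_zero_cancel])
  with wg have "l = (w, g)"
    by (auto simp: prod_eq_iff)
  with wg show "l \<in> A" by simp
qed

text \<open>With j = (I - h A)^-1, the equation x - g z = y is equivalent to x = j ((h / g) y + (1 -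
  h / g) x). This is a contraction with constant |1 - h / g|, which is below 1 exactly for g > h /
  2.\<close>

lemma range_step:
  assumes h: "h > 0" "g > h / 2" and range: "\<And>y. \<exists>x z. (x, z) \<in> A \<and> x - h *\<^sub>R z = y"
  shows "\<exists>x z. (x, z) \<in> A \<and> x - g *\<^sub>R z = y"
proof -
  define c where "c = \<bar>1 - h / g\<bar>"
  have g: "g > 0" using h by simp
  have c: "0 \<le> c" "c < 1"
    using h g by (auto simp: c_def abs_if field_simps)
  obtain j where j: "\<And>y. \<exists>z. (j y, z) \<in> A \<and> j y - h *\<^sub>R z = y"
    using range by metis
  have j_lip: "norm (j a - j b) \<le> norm (a - b)" for a b
  proof -
    obtain z w where "(j a, z) \<in> A" "j a - h *\<^sub>R z = a" "(j b, w) \<in> A" "j b - h *\<^sub>R w = b"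
      using j by meson
    then show ?thesis
      using norm_le_norm_diff[OF diff, of "j a" z "j b" w h] h by (simp add: algebra_simps)
  qed
  define F where "F x = j ((h / g) *\<^sub>R y + (1 - h / g) *\<^sub>R x)" for x
  have "dist (F a) (F b) \<le> c * dist a b" for a b
    using j_lip[of "(h / g) *\<^sub>R y + (1 - h / g) *\<^sub>R a" "(h / g) *\<^sub>R y + (1 - h / g) *\<^sub>R b"]
    by (simp add: F_def dist_norm c_def flip: scaleR_diff_right)
  then obtain x where "F x = x"
    using banach_fix_type[of c F] c by auto
  then obtain z where z: "(x, z) \<in> A" "x - h *\<^sub>R z = (h / g) *\<^sub>R y + (1 - h / g) *\<^sub>R x"
    using j[of "(h / g) *\<^sub>R y + (1 - h / g) *\<^sub>R x"] by (auto simp: F_def)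
  then have "(h / g) *\<^sub>R (x - g *\<^sub>R z) = (h / g) *\<^sub>R y"
    using g by (simp add: algebra_simps)
  then have "x - g *\<^sub>R z = y"
    using g h by simp
  with z show ?thesis by blast
qed

definition step :: "nat \<Rightarrow> real" where "step k = 1 / 2 ^ k"

lemma step_pos [simp]: "step k > 0" and step_Suc: "step (Suc k) = step k / 2"
  and step_tendsto_0: "step \<longlonglongrightarrow> 0"
  unfolding step_def by (auto intro!: LIMSEQ_divide_realpow_zero)

lemma step_nonneg [simp]: "step k \<ge> 0" and step_neq_0 [simp]: "step k \<noteq> 0"
  using step_pos[of k] by linarith+

lemma range_id_minus_step: "\<exists>x z. (x, z) \<in> A \<and> x - step k *\<^sub>R z = y"
proof (induction k arbitrary: y)
  case 0
  show ?case using range_id_minus by (simp add: step_def)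
next
  case (Suc k)
  \<comment> \<open>\<open>range_step\<close> excludes g = h / 2, so one halving is done in two
    moves, by the factors 3/4 and 2/3.\<close>
  have "\<exists>x z. (x, z) \<in> A \<and> x - (3 / 4 * step k) *\<^sub>R z = y" for y
    by (rule range_step[OF _ _ Suc]) simp_all
  from range_step[OF _ _ this, of "step (Suc k)"] show ?case
    by (simp add: step_Suc)
qed

text \<open>The resolvent (I - \<open>step k\<close> A)^-1; \<open>J_in\<close> and
  \<open>J_eqI\<close> show that the chosen value exists and is unique.\<close>

definition J :: "nat \<Rightarrow> 'a \<Rightarrow> 'a" where
  "J k y = (SOME x. \<exists>z. (x, z) \<in> A \<and> x - step k *\<^sub>R z = y)"

lemma J_in: "\<exists>z. (J k y, z) \<in> A \<and> J k y - step k *\<^sub>R z = y"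
  unfolding J_def by (rule someI_ex) (rule range_id_minus_step)

lemma J_eqI:
  assumes "(x, z) \<in> A" "x - step k *\<^sub>R z = y"
  shows "J k y = x"
proof -
  obtain w where w: "(J k y, w) \<in> A" "J k y - step k *\<^sub>R w = y"
    using J_in by blast
  have "norm (J k y - x) \<le> norm ((J k y - step k *\<^sub>R w) - (x - step k *\<^sub>R z))"
    using norm_le_norm_diff[OF diff[OF w(1) assms(1)], of "step k"] by (simp add: algebra_simps)
  then show ?thesis using assms(2) w(2) by simp
qed

text \<open>The value of A at \<open>J k y\<close> is the Yosida approximation of A at y.\<close>

lemma J_graph: "(J k y, (J k y - y) /\<^sub>R step k) \<in> A"
proof -
  obtain z where z: "(J k y, z) \<in> A" "J k y - step k *\<^sub>R z = y"
    using J_in by blast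
  from z(2) have "J k y - y = step k *\<^sub>R z"
    by (simp add: algebra_simps)
  then have "(J k y - y) /\<^sub>R step k = z"
    by simp
  with z show ?thesis by simp
qed

lemma J_add: "J k (x + y) = J k x + J k y"
  by (rule J_eqI[OF add[OF J_graph J_graph]]) (simp add: algebra_simps)

lemma J_scaleC: "J k (c *\<^sub>C x) = c *\<^sub>C J k x"
  by (rule J_eqI[OF scaleC[OF J_graph]])
    (simp add: scaleC_scaleR_commute[symmetric] flip: scaleC_diff_right)

lemma norm_J: "norm (J k x) \<le> norm x"
  using norm_le_norm_diff[OF J_graph, of "step k" k x] by simp

text \<open>The guess for the resolvent at x is x + \<open>step k\<close> times
  \<open>J k y\<close>: A maps it to y + (\<open>J k y\<close> - y) = \<open>J k y\<close>, and
  subtracting \<open>step k\<close> times this value gives x back.\<close>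

lemma J_graph_commute:
  assumes "(x, y) \<in> A"
  shows "(J k x, J k y) \<in> A" and "J k x = x + step k *\<^sub>R J k y"
proof -
  have "(x + step k *\<^sub>R J k y, y + step k *\<^sub>R ((J k y - y) /\<^sub>R step k)) \<in> A"
    by (intro add scaleR assms J_graph)
  then have *: "(x + step k *\<^sub>R J k y, J k y) \<in> A"
    by simp
  show "J k x = x + step k *\<^sub>R J k y"
    by (rule J_eqI[OF *]) simp
  with * show "(J k x, J k y) \<in> A" by simp
qed

lemma funpow_J_add: "(J k ^^ n) (x + y) = (J k ^^ n) x + (J k ^^ n) y"
  by (induction n arbitrary: x y) (simp_all add: J_add)

lemma funpow_J_scaleC: "(J k ^^ n) (c *\<^sub>C x) = c *\<^sub>C (J k ^^ n) x"
  by (induction n arbitrary: x) (simp_all add: J_scaleC)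

lemma funpow_J_diff: "(J k ^^ n) (x - y) = (J k ^^ n) x - (J k ^^ n) y"
  using funpow_J_add[of n k "x - y" y] by simp

lemma norm_funpow_J: "norm ((J k ^^ n) x) \<le> norm x"
  by (induction n) (auto intro: order_trans[OF norm_J])

lemma funpow_J_step:
  assumes "(x, y) \<in> A"
  shows "norm ((J k ^^ n) x - x) \<le> real n * step k * norm y"
proof (induction n)
  case (Suc n)
  have "(J k ^^ Suc n) x - x = (J k ^^ n) (step k *\<^sub>R J k y) + ((J k ^^ n) x - x)"
    using J_graph_commute(2)[OF assms] by (simp add: funpow_J_add funpow_Suc_right del: funpow.simps)
  also have "norm \<dots> \<le> step k * norm y + real n * step k * norm y"
  proof (rule norm_triangle_mono[OF _ Suc])
    show "norm ((J k ^^ n) (step k *\<^sub>R J k y)) \<le> step k * norm y"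
      by (rule order_trans[OF norm_funpow_J]) (simp add: norm_J)
  qed
  finally show ?case by (simp add: algebra_simps)
qed simp

text \<open>Serves to absorb rounding: where floors miss each other by at most one, n is 0 or 1 and
  the cost is at most \<open>step k\<close> times |y|.\<close>

lemma funpow_J_diff_le:
  assumes "(x, y) \<in> A"
  shows "norm ((J k ^^ (m + n)) x - (J k ^^ m) x) \<le> real n * step k * norm y"
  using norm_funpow_J[of m k "(J k ^^ n) x - x"] funpow_J_step[OF assms, of n k]
  by (simp add: funpow_add funpow_J_diff)

text \<open>With \<open>g = step (Suc k)\<close>, subtracting \<open>(I - gA)\<^sup>-\<^sup>2\<close> from \<open>(I - 2gA)\<^sup>-\<^sup>1\<close> leaves
  \<open>g\<^sup>2 (I - 2gA)\<^sup>-\<^sup>1 (I - gA)\<^sup>-\<^sup>2 A\<^sup>2\<close>.\<close>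

lemma J_halve_step:
  assumes "(x, y) \<in> A" "(y, z) \<in> A"
  shows "norm (J k x - J (Suc k) (J (Suc k) x)) \<le> (step k)\<^sup>2 / 4 * norm z"
proof -
  define g where "g = step (Suc k)"
  define P where "P = J (Suc k)"
  have Px: "P x = x + g *\<^sub>R P y" "P (P x) = P x + g *\<^sub>R P (P y)" "P (P y) = P y + g *\<^sub>R P (P z)"
    using J_graph_commute assms unfolding P_def g_def by metis+
  have in_A: "(P (P x), P (P y)) \<in> A"
    using J_graph_commute assms unfolding P_def by metis
  have "J k (x - (g * g) *\<^sub>R P (P z)) = P (P x)"
  proof (rule J_eqI[OF in_A])
    have g_PPy: "g *\<^sub>R P (P y) = g *\<^sub>R P y + (g * g) *\<^sub>R P (P z)"
      by (subst Px(3)) (simp add: scaleR_add_right)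
    have "step k *\<^sub>R P (P y) = g *\<^sub>R P (P y) + g *\<^sub>R P (P y)"
      by (simp add: g_def step_Suc flip: scaleR_add_left)
    then have "P (P x) - step k *\<^sub>R P (P y) = P x - g *\<^sub>R P (P y)"
      using Px(2) by simp
    also have "\<dots> = x + g *\<^sub>R P y - g *\<^sub>R P (P y)"
      using Px(1) by simp
    also have "\<dots> = x - (g * g) *\<^sub>R P (P z)"
      unfolding g_PPy by simp
    finally show "P (P x) - step k *\<^sub>R P (P y) = x - (g * g) *\<^sub>R P (P z)" .
  qed
  then have "J k x - P (P x) = J k ((g * g) *\<^sub>R P (P z))"
    using J_add[of k "x - (g * g) *\<^sub>R P (P z)" "(g * g) *\<^sub>R P (P z)"] by simp
  also have "norm \<dots> \<le> norm ((g * g) *\<^sub>R P (P z))"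
    by (rule norm_J)
  also have "\<dots> \<le> (g * g) * norm z"
    using order_trans[OF norm_J norm_J, of "Suc k" "Suc k" z]
    by (simp add: P_def mult_left_mono)
  finally show ?thesis
    by (simp add: P_def g_def step_Suc power2_eq_square)
qed

text \<open>Coarse factors are replaced by pairs of fine ones, one at a time. All resolvents are
  contractions, and such a pair maps x, y, z to another chain in the graph without enlarging z, so
  the n errors of \<open>J_halve_step\<close> simply add up.\<close>

lemma funpow_J_halve_step:
  assumes "(x, y) \<in> A" "(y, z) \<in> A"
  shows "norm ((J k ^^ n) x - (J (Suc k) ^^ (2 * n)) x) \<le> real n * ((step k)\<^sup>2 / 4 * norm z)"
  using assms
proof (induction n arbitrary: x y z)
  case (Suc n)
  let ?P = "\<lambda>x. J (Suc k) (J (Suc k) x)"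
  have P: "(?P x, ?P y) \<in> A" "(?P y, ?P z) \<in> A"
    using J_graph_commute Suc.prems by metis+
  have "(J k ^^ Suc n) x - (J (Suc k) ^^ (2 * Suc n)) x =
      (J k ^^ n) (J k x - ?P x) + ((J k ^^ n) (?P x) - (J (Suc k) ^^ (2 * n)) (?P x))"
    by (simp add: funpow_J_diff funpow_Suc_right del: funpow.simps)
  also have "norm \<dots> \<le> (step k)\<^sup>2 / 4 * norm z + real n * ((step k)\<^sup>2 / 4 * norm (?P z))"
    by (intro norm_triangle_mono order_trans[OF norm_funpow_J] J_halve_step[OF Suc.prems]
        Suc.IH[OF P])
  also have "\<dots> \<le> (step k)\<^sup>2 / 4 * norm z + real n * ((step k)\<^sup>2 / 4 * norm z)"
    using order_trans[OF norm_J norm_J, of "Suc k" "Suc k" z]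
    by (intro add_left_mono mult_left_mono) simp_all
  finally show ?case by (simp add: algebra_simps)
qed simp

text \<open>Writing \<open>a = J k y - y\<close> and \<open>b = J l y - y\<close> with \<open>step l \<le> step k\<close>, dissipativity gives
  \<open>\<parallel>a - b\<parallel>\<^sup>2 \<le> \<parallel>a\<parallel>\<^sup>2 - \<parallel>b\<parallel>\<^sup>2\<close>, so \<open>J k y\<close> converges. Its limit is \<open>y\<close> because \<open>A\<close> maps
  \<open>step k *\<^sub>R J k y\<close>, which tends to \<open>0\<close>, to \<open>J k y - y\<close>.\<close>

lemma J_tendsto: "(\<lambda>k. J k y) \<longlonglongrightarrow> y"
proof -
  define a where "a k = J k y - y" for k
  have mono: "(norm (a k - a (k + i)))\<^sup>2 \<le> (norm (a k))\<^sup>2 - (norm (a (k + i)))\<^sup>2" for k i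
  proof -
    define p where "p = (2::real) ^ k"
    define q where "q = (2::real) ^ (k + i)"
    have pq: "0 < p" "p \<le> q" unfolding p_def q_def by (auto intro: power_increasing)
    have step: "inverse (step k) = p" "inverse (step (k + i)) = q"
      by (simp_all add: p_def q_def step_def)
    have "rip (p *\<^sub>R a k - q *\<^sub>R a (k + i)) (a k - a (k + i)) \<le> 0"
      using dissipative[OF diff[OF J_graph[of k y] J_graph[of "k + i" y]]]
      unfolding step by (simp add: a_def)
    then have "p * (norm (a k))\<^sup>2 + q * (norm (a (k + i)))\<^sup>2 \<le> (p + q) * rip (a k) (a (k + i))"
      by (simp add: rip.diff_left rip.diff_right rip.scaleR_left power2_norm_eq_rip
          rip_commute[of "a (i + k)" "a k"] algebra_simps)
    also have "rip (a k) (a (k + i))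
        = ((norm (a k))\<^sup>2 + (norm (a (k + i)))\<^sup>2 - (norm (a k - a (k + i)))\<^sup>2) / 2"
      by (simp add: norm_diff_squared)
    finally have le: "(p + q) * (norm (a k - a (k + i)))\<^sup>2
        \<le> (q - p) * ((norm (a k))\<^sup>2 - (norm (a (k + i)))\<^sup>2)"
      by (simp add: field_simps)
    \<comment> \<open>Enlarging q - p to p + q needs the sign of the other factor; \<open>le\<close>
      yields it for p < q, and for p = q it gives \<open>a k = a (k + i)\<close>.\<close>
    have nonneg: "0 \<le> (norm (a k))\<^sup>2 - (norm (a (k + i)))\<^sup>2"
    proof (cases "p = q")
      case True
      with le pq have "a k = a (k + i)" by (simp add: mult_le_0_iff)
      then show ?thesis by simp
    next
      case False
      have "0 \<le> (p + q) * (norm (a k - a (k + i)))\<^sup>2" using pq by simp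
      with le have "0 \<le> (q - p) * ((norm (a k))\<^sup>2 - (norm (a (k + i)))\<^sup>2)" by linarith
      with False pq show ?thesis by (simp add: zero_le_mult_iff)
    qed
    have "(q - p) * ((norm (a k))\<^sup>2 - (norm (a (k + i)))\<^sup>2)
        \<le> (p + q) * ((norm (a k))\<^sup>2 - (norm (a (k + i)))\<^sup>2)"
      using pq nonneg by (intro mult_right_mono) auto
    with le have "(p + q) * (norm (a k - a (k + i)))\<^sup>2
        \<le> (p + q) * ((norm (a k))\<^sup>2 - (norm (a (k + i)))\<^sup>2)" by linarith
    then show ?thesis using pq by simp
  qed
  have "decseq (\<lambda>k. (norm (a k))\<^sup>2)"
    unfolding decseq_def
  proof (intro allI impI)
    fix m n :: nat assume "m \<le> n"
    then obtain i where "n = m + i" by (auto simp: le_iff_add)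
    with mono[of m i] zero_le_power2[of "norm (a m - a (m + i))"]
    show "(norm (a n))\<^sup>2 \<le> (norm (a m))\<^sup>2" unfolding \<open>n = m + i\<close> by linarith
  qed
  then have "convergent (\<lambda>k. (norm (a k))\<^sup>2)"
    using decseq_convergent[of "\<lambda>k. (norm (a k))\<^sup>2" 0] by (meson convergentI zero_le_power2)
  then have cauchy: "Cauchy (\<lambda>k. (norm (a k))\<^sup>2)"
    by (rule convergent_Cauchy)
  have "Cauchy a"
    unfolding Cauchy_altdef
  proof (intro allI impI)
    fix e :: real assume "e > 0"
    then obtain M where M: "\<And>m n. m \<ge> M \<Longrightarrow> n > m \<Longrightarrow> dist ((norm (a m))\<^sup>2) ((norm (a n))\<^sup>2) < e\<^sup>2"
      using cauchy unfolding Cauchy_altdef by (meson zero_less_power)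
    have "dist (a m) (a n) < e" if mn: "m \<ge> M" "n > m" for m n
    proof -
      obtain i where i: "n = m + i" using mn(2) by (auto simp: less_iff_Suc_add)
      have "(norm (a m - a n))\<^sup>2 < e\<^sup>2"
        using mono[of m i] M[OF mn] unfolding i dist_real_def by linarith
      then show ?thesis
        using \<open>e > 0\<close> by (simp add: dist_norm power_less_imp_less_base)
    qed
    then show "\<exists>M. \<forall>m\<ge>M. \<forall>n>m. dist (a m) (a n) < e" by blast
  qed
  then obtain r where r: "a \<longlonglongrightarrow> r"
    using Cauchy_convergent convergent_def by blast
  have in_A: "(step k *\<^sub>R (a k + y), a k) \<in> A" for k
    using scaleR[OF J_graph[of k y], of "step k"] by (simp add: a_def)
  have "(\<lambda>k. (step k *\<^sub>R (a k + y), a k)) \<longlonglongrightarrow> (0 *\<^sub>R (r + y), r)"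
    by (intro tendsto_intros r step_tendsto_0)
  then have "(0, r) \<in> A"
    using closed_sequentially[OF closed, of "\<lambda>k. (step k *\<^sub>R (a k + y), a k)" "(0, r)"] in_A by simp
  then have "r = 0"
    using unique operator_zero[OF subspace] by blast
  with r show ?thesis
    by (simp add: a_def[abs_def] LIM_zero_cancel)
qed

lemma J_J_in: "\<exists>y z. (J k (J k x), y) \<in> A \<and> (y, z) \<in> A"
  using J_graph_commute(1)[OF J_graph] J_graph by meson

text \<open>Applying the contraction \<open>J k\<close> twice leads into the domain of the square of
  A, and the resulting point is at most twice as far from x as \<open>J k x\<close> is.\<close>

lemma dense_domain_square:
  assumes "e > 0"
  obtains x' y z where "norm (x - x') < e" "(x', y) \<in> A" "(y, z) \<in> A"
proof -
  obtain k where k: "norm (J k x - x) < e / 2"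
    using LIMSEQ_D[OF J_tendsto[of x], of "e / 2"] assms by (meson half_gt_zero order_refl)
  have "norm (J k (J k x) - x) \<le> norm (J k (J k x - x)) + norm (J k x - x)"
    using norm_triangle_ineq[of "J k (J k x - x)" "J k x - x"] J_add[of k "J k x - x" x] by (simp add: add_diff_eq)
  with k norm_J[of k "J k x - x"] have "norm (x - J k (J k x)) < e"
    by (simp add: norm_minus_commute)
  with J_J_in that show ?thesis by blast
qed

section \<open>Convergence of the implicit Euler approximations\<close>

definition euler :: "nat \<Rightarrow> real \<Rightarrow> 'a \<Rightarrow> 'a" where
  "euler k t x = (J k ^^ nat \<lfloor>t * 2 ^ k\<rfloor>) x"

lemma norm_euler: "norm (euler k t x) \<le> norm x"
  by (simp add: euler_def norm_funpow_J)

lemma euler_diff: "euler k t (x - y) = euler k t x - euler k t y"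
  by (simp add: euler_def funpow_J_diff)

lemma floor_step_le: "t \<ge> 0 \<Longrightarrow> real (nat \<lfloor>t * 2 ^ k\<rfloor>) * step k \<le> t"
  using of_int_floor_le[of "t * 2 ^ k"] by (simp add: step_def field_simps)

lemma convergent_euler_domain_square:
  assumes t: "t \<ge> 0" and xyz: "(x, y) \<in> A" "(y, z) \<in> A"
  shows "convergent (\<lambda>k. euler k t x)"
proof -
  \<comment> \<open>|y| / 2 pays for a possible extra fine step, and t |z| / 4 pays for n <= t /
    \<open>step k\<close> halvings, each of cost \<open>(step k)\<^sup>2\<close> |z| / 4.\<close>
  define C where "C = t * norm z / 4 + norm y / 2"
  have bound: "norm (euler (Suc k) t x - euler k t x) \<le> C * (1 / 2) ^ k" for k
  proof -
    define n where "n = nat \<lfloor>t * 2 ^ k\<rfloor>"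
    define m where "m = nat \<lfloor>t * 2 ^ Suc k\<rfloor>"
    have n: "real n = of_int \<lfloor>t * 2 ^ k\<rfloor>" and m: "real m = of_int \<lfloor>t * 2 ^ Suc k\<rfloor>"
      using t by (simp_all add: n_def m_def)
    have "real n \<le> t * 2 ^ k" "t * 2 ^ k < real n + 1" "real m \<le> t * 2 ^ k * 2" "t * 2 ^ k * 2 < real m + 1"
      unfolding n m by (simp_all add: algebra_simps) linarith+
    \<comment> \<open>Doubling the rounded number of coarse steps loses at most one fine
      step.\<close>
    then have "2 * n \<le> m" "m - 2 * n \<le> 1" by linarith+
    then have "norm ((J (Suc k) ^^ (2 * n + (m - 2 * n))) x - (J (Suc k) ^^ (2 * n)) x) \<le> step (Suc k) * norm y"
      by (intro order_trans[OF funpow_J_diff_le[OF xyz(1)]])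
        (cases "m - 2 * n", simp_all)
    then have "norm ((J (Suc k) ^^ m) x - (J (Suc k) ^^ (2 * n)) x) \<le> step (Suc k) * norm y"
      using \<open>2 * n \<le> m\<close> by simp
    moreover have "norm ((J (Suc k) ^^ (2 * n)) x - (J k ^^ n) x) \<le> real n * ((step k)\<^sup>2 / 4 * norm z)"
      using funpow_J_halve_step[OF xyz, of n k] by (simp add: norm_minus_commute)
    ultimately have "norm (euler (Suc k) t x - euler k t x)
        \<le> step (Suc k) * norm y + real n * ((step k)\<^sup>2 / 4 * norm z)"
      unfolding euler_def n_def[symmetric] m_def[symmetric]
      by (rule norm_diff_triangle_le)
    also have "real n * ((step k)\<^sup>2 / 4 * norm z) = (real n * step k) * (step k * norm z / 4)"
      by (simp add: power2_eq_square)
    also have "\<dots> \<le> t * (step k * norm z / 4)"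
      unfolding n_def using floor_step_le[OF t, of k]
      by (intro mult_right_mono) auto
    finally show ?thesis
      by (simp add: C_def step_Suc step_def power_divide field_simps)
  qed
  have "summable (\<lambda>k. C * (1 / 2) ^ k)"
    by (intro summable_mult summable_geometric) simp
  then have "summable (\<lambda>k. euler (Suc k) t x - euler k t x)"
    by (rule summable_comparison_test') (rule bound)
  then have "convergent (\<lambda>n. \<Sum>k<n. euler (Suc k) t x - euler k t x)"
    by (simp add: summable_iff_convergent)
  then have "convergent (\<lambda>n. euler n t x - euler 0 t x)"
    unfolding sum_lessThan_telescope[of "\<lambda>k. euler k t x"] .
  then show ?thesis
    using convergent_add_const_right_iff[of "\<lambda>n. euler n t x" "- euler 0 t x"] by simp
qed

lemma convergent_euler:
  assumes t: "t \<ge> 0"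
  shows "convergent (\<lambda>k. euler k t x)"
proof (rule Cauchy_convergent)
  show "Cauchy (\<lambda>k. euler k t x)"
    unfolding Cauchy_altdef
  proof (intro allI impI)
    fix e :: real assume "e > 0"
    then obtain x' y z where x': "norm (x - x') < e / 4" "(x', y) \<in> A" "(y, z) \<in> A"
      using dense_domain_square[of "e / 4" x] by auto
    have "Cauchy (\<lambda>k. euler k t x')"
      by (rule convergent_Cauchy convergent_euler_domain_square[OF t x'(2,3)])+
    then obtain M where M: "\<forall>m\<ge>M. \<forall>n>m. dist (euler m t x') (euler n t x') < e / 2"
      using \<open>e > 0\<close> unfolding Cauchy_altdef by (meson half_gt_zero)
    have close: "dist (euler k t x) (euler k t x') < e / 4" for k
      using norm_euler[of k t "x - x'"] x'(1) by (simp add: dist_norm euler_diff)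
    have "dist (euler m t x) (euler n t x) < e" if "m \<ge> M" "n > m" for m n
    proof -
      have "dist (euler m t x') (euler n t x') < e / 2" using M that by blast
      with close[of m] close[of n]
        dist_triangle[of "euler m t x" "euler n t x" "euler m t x'"]
        dist_triangle2[of "euler m t x'" "euler n t x" "euler n t x'"]
      show ?thesis by linarith
    qed
    then show "\<exists>M. \<forall>m\<ge>M. \<forall>n>m. dist (euler m t x) (euler n t x) < e" by blast
  qed
qed

section \<open>The limit semigroup and its generator\<close>

definition semigroup :: "real \<Rightarrow> 'a \<Rightarrow> 'a" where
  "semigroup t x = lim (\<lambda>k. euler k t x)"

lemma euler_tendsto: "t \<ge> 0 \<Longrightarrow> (\<lambda>k. euler k t x) \<longlonglongrightarrow> semigroup t x"
  unfolding semigroup_def using convergent_euler by (simp add: convergent_LIMSEQ_iff)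

lemma norm_semigroup: "t \<ge> 0 \<Longrightarrow> norm (semigroup t x) \<le> norm x"
  by (rule LIMSEQ_le_const2[OF tendsto_norm[OF euler_tendsto]]) (auto simp: norm_euler)

lemma semigroup_add_right: "t \<ge> 0 \<Longrightarrow> semigroup t (x + y) = semigroup t x + semigroup t y"
  by (rule LIMSEQ_unique[OF euler_tendsto])
    (auto simp: euler_def funpow_J_add intro!: tendsto_add euler_tendsto[unfolded euler_def])

lemma semigroup_scaleC: "t \<ge> 0 \<Longrightarrow> semigroup t (c *\<^sub>C x) = c *\<^sub>C semigroup t x"
  by (rule LIMSEQ_unique[OF euler_tendsto])
    (auto simp: euler_def funpow_J_scaleC intro!: tendsto_scaleC euler_tendsto[unfolded euler_def])

lemma semigroup_diff: "t \<ge> 0 \<Longrightarrow> semigroup t (x - y) = semigroup t x - semigroup t y"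
  using semigroup_add_right[of t "x - y" y] by simp

lemma bounded_linear_semigroup: "t \<ge> 0 \<Longrightarrow> bounded_linear (semigroup t)"
  by (rule bounded_linear_intro[where K = 1])
    (simp_all add: semigroup_add_right norm_semigroup semigroup_scaleC flip: scaleC_of_real)

lemma semigroup_lipschitz:
  assumes "0 \<le> s" "0 \<le> t" "(x, y) \<in> A"
  shows "norm (semigroup s x - semigroup t x) \<le> \<bar>s - t\<bar> * norm y"
proof -
  have *: "norm (semigroup t x - semigroup s x) \<le> (t - s) * norm y" if st: "0 \<le> s" "s \<le> t" for s t
  proof -
    \<comment> \<open>Rounding can add at most one step to (t - s) 2^k; its contribution disappears
      in the limit.\<close>
    have "norm (euler k t x - euler k s x) \<le> (t - s + step k) * norm y" for k
    proof -
      define n where "n = nat \<lfloor>s * 2 ^ k\<rfloor>"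
      define m where "m = nat \<lfloor>t * 2 ^ k\<rfloor>"
      have "n \<le> m" unfolding n_def m_def using st by (intro nat_mono floor_mono) simp
      have n: "real n = of_int \<lfloor>s * 2 ^ k\<rfloor>" and m: "real m = of_int \<lfloor>t * 2 ^ k\<rfloor>"
        using st by (simp_all add: n_def m_def)
      have "norm ((J k ^^ m) x - (J k ^^ n) x) \<le> real (m - n) * step k * norm y"
        using funpow_J_diff_le[OF assms(3), of n "m - n" k] \<open>n \<le> m\<close> by simp
      also have "real (m - n) * step k \<le> t - s + step k"
      proof -
        have "real (m - n) \<le> (t - s) * 2 ^ k + 1"
          using of_int_floor_le[of "t * 2 ^ k"] floor_correct[of "s * 2 ^ k"]
          unfolding of_nat_diff[OF \<open>n \<le> m\<close>] n m left_diff_distrib by linarith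
        then have "real (m - n) * step k \<le> ((t - s) * 2 ^ k + 1) * step k"
          by (intro mult_right_mono) simp_all
        then show ?thesis by (simp add: step_def field_simps)
      qed
      finally show ?thesis
        by (simp add: euler_def n_def m_def mult_right_mono)
    qed
    moreover have "(\<lambda>k. (t - s + step k) * norm y) \<longlonglongrightarrow> (t - s + 0) * norm y"
      by (intro tendsto_intros step_tendsto_0)
    moreover have "(\<lambda>k. norm (euler k t x - euler k s x)) \<longlonglongrightarrow> norm (semigroup t x - semigroup s x)"
      using st by (intro tendsto_intros euler_tendsto) auto
    ultimately show ?thesis
      using LIMSEQ_le by (metis (no_types, lifting) add.right_neutral)
  qed
  show ?thesis
    using *[of s t] *[of t s] assms by (cases "s \<le> t") (auto simp: norm_minus_commute)
qed

lemma semigroup_0: "semigroup 0 = id"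
proof
  show "semigroup 0 x = id x" for x
    using LIMSEQ_unique[OF euler_tendsto[of 0 x]] by (simp add: euler_def)
qed

text \<open>floor (2^k (s + t)) exceeds floor (2^k s) + floor (2^k t) by at most one, and on the
  domain one extra step costs \<open>step k\<close> times |y|, which vanishes in the limit. The
  nested approximations converge because the outer one is contractive for every k. The passage to
  arbitrary x uses that \<open>J k x\<close> tends to x.\<close>

lemma semigroup_plus:
  assumes st: "0 \<le> s" "0 \<le> t"
  shows "semigroup (s + t) x = semigroup s (semigroup t x)"
proof -
  have E: "(\<lambda>k. euler k s (euler k t x)) \<longlonglongrightarrow> semigroup s (semigroup t x)" for x
  proof -
    have "(\<lambda>k. euler k s (euler k t x - semigroup t x)) \<longlonglongrightarrow> 0"
    proof (rule Lim_null_comparison[OF always_eventually])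
      show "\<forall>k. norm (euler k s (euler k t x - semigroup t x)) \<le> norm (euler k t x - semigroup t x)"
        by (simp add: norm_euler)
      show "(\<lambda>k. norm (euler k t x - semigroup t x)) \<longlonglongrightarrow> 0"
        by (rule tendsto_norm_zero, rule LIM_zero, rule euler_tendsto[OF st(2)])
    qed
    from tendsto_add[OF this euler_tendsto[OF st(1), of "semigroup t x"]] show ?thesis
      by (simp add: euler_diff)
  qed
  have on_domain: "semigroup (s + t) x = semigroup s (semigroup t x)" if "(x, y) \<in> A" for x y
  proof -
    have "(\<lambda>k. euler k (s + t) x - euler k s (euler k t x)) \<longlonglongrightarrow> 0"
    proof (rule Lim_null_comparison[OF always_eventually])
      show "\<forall>k. norm (euler k (s + t) x - euler k s (euler k t x)) \<le> step k * norm y"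
      proof
        fix k
        define l where "l = nat \<lfloor>(s + t) * 2 ^ k\<rfloor>"
        define n where "n = nat \<lfloor>s * 2 ^ k\<rfloor>"
        define m where "m = nat \<lfloor>t * 2 ^ k\<rfloor>"
        have n: "real n = of_int \<lfloor>s * 2 ^ k\<rfloor>" and m: "real m = of_int \<lfloor>t * 2 ^ k\<rfloor>"
          and l: "real l = of_int \<lfloor>(s + t) * 2 ^ k\<rfloor>"
          using st by (simp_all add: n_def m_def l_def)
        have "real l \<le> s * 2 ^ k + t * 2 ^ k" "s * 2 ^ k + t * 2 ^ k < real l + 1"
          "real n \<le> s * 2 ^ k" "s * 2 ^ k < real n + 1" "real m \<le> t * 2 ^ k" "t * 2 ^ k < real m + 1"
          unfolding l n m by (simp_all add: algebra_simps) linarith+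
        then have "n + m \<le> l" "l - (n + m) \<le> 1" by linarith+
        then have "norm ((J k ^^ (n + m + (l - (n + m)))) x - (J k ^^ (n + m)) x) \<le> step k * norm y"
          by (intro order_trans[OF funpow_J_diff_le[OF that]])
            (cases "l - (n + m)", simp_all)
        then show "norm (euler k (s + t) x - euler k s (euler k t x)) \<le> step k * norm y"
          using \<open>n + m \<le> l\<close> by (simp add: euler_def l_def[symmetric] n_def[symmetric] m_def[symmetric] funpow_add)
      qed
      show "(\<lambda>k. step k * norm y) \<longlonglongrightarrow> 0"
        using tendsto_mult_right[OF step_tendsto_0, of "norm y"] by simp
    qed
    from tendsto_add[OF this E[of x]] have "(\<lambda>k. euler k (s + t) x) \<longlonglongrightarrow> semigroup s (semigroup t x)"
      by simp
    then show ?thesis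
      using LIMSEQ_unique[OF euler_tendsto[of "s + t" x]] st by simp
  qed
  have lim: "(\<lambda>k. semigroup r (J k x)) \<longlonglongrightarrow> semigroup r x" if "r \<ge> 0" for r x
    using bounded_linear.tendsto[OF bounded_linear_semigroup[OF that] J_tendsto] .
  have "(\<lambda>k. semigroup (s + t) (J k x)) \<longlonglongrightarrow> semigroup s (semigroup t x)"
    using bounded_linear.tendsto[OF bounded_linear_semigroup[OF st(1)] lim[OF st(2), of x]]
    by (simp add: on_domain[OF J_graph])
  with lim[of "s + t" x] st show ?thesis
    by (simp add: LIMSEQ_unique)
qed

lemma continuous_semigroup: "continuous_on {0..} (\<lambda>t. semigroup t x)"
  unfolding continuous_on_iff
proof (intro ballI allI impI)
  fix t e :: real assume t: "t \<in> {0..}" and e: "e > 0"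
  obtain x' y z where x': "norm (x - x') < e / 4" "(x', y) \<in> A" "(y, z) \<in> A"
    using dense_domain_square[of "e / 4" x] e by auto
  define d where "d = e / 2 / (norm y + 1)"
  have d: "d > 0" using e by (simp add: d_def add_nonneg_pos)
  have "dist (semigroup s x) (semigroup t x) < e" if s: "s \<in> {0..}" "dist s t < d" for s
  proof -
    have "norm (semigroup s x' - semigroup t x') \<le> \<bar>s - t\<bar> * norm y"
      using semigroup_lipschitz[OF _ _ x'(2)] s t by simp
    also have "\<dots> \<le> d * (norm y + 1)"
      using s(2) d by (intro mult_mono) (auto simp: dist_real_def)
    also have "\<dots> = e / 2" using d d_def by (metis nonzero_eq_divide_eq divide_eq_0_iff less_irrefl)
    finally have 1: "norm (semigroup s x' - semigroup t x') \<le> e / 2" .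
    have 2: "norm (semigroup r x - semigroup r x') < e / 4" if "r \<ge> 0" for r
      using norm_semigroup[OF that, of "x - x'"] x'(1) by (simp add: semigroup_diff that)
    have "semigroup s x - semigroup t x = (semigroup s x - semigroup s x')
        + (semigroup s x' - semigroup t x') - (semigroup t x - semigroup t x')" by simp
    also have "norm \<dots> \<le> norm (semigroup s x - semigroup s x')
        + norm (semigroup s x' - semigroup t x') + norm (semigroup t x - semigroup t x')"
      by (rule order_trans[OF norm_triangle_ineq4 add_right_mono[OF norm_triangle_ineq]])
    finally show ?thesis
      using 1 2[of s] 2[of t] s t unfolding dist_norm by force
  qed
  with d show "\<exists>d>0. \<forall>s\<in>{0..}. dist s t < d \<longrightarrow> dist (semigroup s x) (semigroup t x) < e"
    by blast
qed

lemma contraction_semigroup: "contraction_semigroup semigroup"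
  unfolding contraction_semigroup_def C0_semigroup_def
  by (auto simp: bounded_linear_semigroup semigroup_0 semigroup_plus continuous_semigroup
      norm_semigroup semigroup_add_right semigroup_scaleC intro!: clinearI)

text \<open>Since \<open>J k x\<close> - x is \<open>step k\<close> times \<open>J k y\<close>, the
  error is \<open>step k\<close> times the sum of \<open>(J k ^^ i) y - y\<close> over i = 1..n. As
  y need not lie in the domain, each term is estimated through a point y' of the domain, at the
  price 2 |y - y'|.\<close>

lemma funpow_J_first_order:
  assumes "(x, y) \<in> A" and "(y', z') \<in> A"
  shows "norm ((J k ^^ n) x - x - (real n * step k) *\<^sub>R y)
      \<le> real n * step k * (2 * norm (y - y') + real n * step k * norm z')"
proof -
  let ?b = "2 * norm (y - y') + real n * step k * norm z'"
  have J_y: "norm ((J k ^^ j) y - y) \<le> ?b" if "j \<le> n" for j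
  proof -
    have "(J k ^^ j) y - y = (J k ^^ j) (y - y') + ((J k ^^ j) y' - y') - (y - y')"
      by (simp add: funpow_J_diff)
    also have "norm \<dots> \<le> norm ((J k ^^ j) (y - y')) + norm ((J k ^^ j) y' - y') + norm (y - y')"
      by (rule order_trans[OF norm_triangle_ineq4 add_right_mono[OF norm_triangle_ineq]])
    finally have "norm ((J k ^^ j) y - y)
        \<le> norm ((J k ^^ j) (y - y')) + norm ((J k ^^ j) y' - y') + norm (y - y')" .
    moreover have "real j * step k * norm z' \<le> real n * step k * norm z'"
      using that by (intro mult_right_mono) auto
    ultimately show ?thesis
      using norm_funpow_J[of j k "y - y'"] funpow_J_step[OF assms(2), of j k] by linarith
  qed
  have "norm ((J k ^^ i) x - x - (real i * step k) *\<^sub>R y) \<le> real i * step k * ?b" if "i \<le> n" for i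
    using that
  proof (induction i)
    case (Suc i)
    have graph: "((J k ^^ i) x, (J k ^^ i) y) \<in> A" for i
      by (induction i) (simp_all add: assms(1) J_graph_commute(1))
    have "(J k ^^ Suc i) x - x - (real (Suc i) * step k) *\<^sub>R y
        = ((J k ^^ i) x - x - (real i * step k) *\<^sub>R y) + step k *\<^sub>R ((J k ^^ Suc i) y - y)"
      using J_graph_commute(2)[OF graph[of i]] by (simp add: algebra_simps)
    also have "norm \<dots> \<le> real i * step k * ?b + step k * ?b"
    proof (rule norm_triangle_mono)
      show "norm (step k *\<^sub>R ((J k ^^ Suc i) y - y)) \<le> step k * ?b"
        using J_y[OF Suc.prems] by (simp add: mult_left_mono del: funpow.simps)
    qed (use Suc in simp)
    finally show ?case by (simp add: algebra_simps)
  qed simp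
  then show ?thesis by blast
qed

lemma semigroup_first_order:
  assumes "(x, y) \<in> A" and "(y', z') \<in> A" and t: "t \<ge> 0"
  shows "norm (semigroup t x - x - t *\<^sub>R y) \<le> t * (2 * norm (y - y') + t * norm z')"
proof -
  have lim: "(\<lambda>k. real (nat \<lfloor>t * 2 ^ k\<rfloor>) * step k) \<longlonglongrightarrow> t"
  proof (rule tendsto_sandwich[OF always_eventually always_eventually])
    show "\<forall>k. t - step k \<le> real (nat \<lfloor>t * 2 ^ k\<rfloor>) * step k"
    proof
      fix k
      have "(t * 2 ^ k - 1) * step k \<le> real (nat \<lfloor>t * 2 ^ k\<rfloor>) * step k"
      proof (rule mult_right_mono)
        have "t * 2 ^ k - 1 \<le> of_int \<lfloor>t * 2 ^ k\<rfloor>" by linarith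
        with t show "t * 2 ^ k - 1 \<le> real (nat \<lfloor>t * 2 ^ k\<rfloor>)" by simp
      qed simp
      then show "t - step k \<le> real (nat \<lfloor>t * 2 ^ k\<rfloor>) * step k"
        by (simp add: step_def field_simps)
    qed
    show "\<forall>k. real (nat \<lfloor>t * 2 ^ k\<rfloor>) * step k \<le> t"
      using floor_step_le[OF t] by blast
    show "(\<lambda>k. t - step k) \<longlonglongrightarrow> t"
      using tendsto_diff[OF tendsto_const step_tendsto_0] by simp
  qed simp
  show ?thesis
  proof (rule LIMSEQ_le)
    show "(\<lambda>k. norm (euler k t x - x - (real (nat \<lfloor>t * 2 ^ k\<rfloor>) * step k) *\<^sub>R y))
        \<longlonglongrightarrow> norm (semigroup t x - x - t *\<^sub>R y)"
      by (intro tendsto_intros lim euler_tendsto t)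
    show "(\<lambda>k. real (nat \<lfloor>t * 2 ^ k\<rfloor>) * step k
            * (2 * norm (y - y') + real (nat \<lfloor>t * 2 ^ k\<rfloor>) * step k * norm z'))
        \<longlonglongrightarrow> t * (2 * norm (y - y') + t * norm z')"
      by (intro tendsto_intros lim)
  qed (auto simp: euler_def funpow_J_first_order[OF assms(1,2)])
qed

text \<open>Dividing \<open>semigroup_first_order\<close> by t leaves 2 |y - y'| + t |z'|: first y'
  is taken close to y, which fixes z', and then t is taken small.\<close>

lemma subset_generator: "A \<subseteq> semigroup_generator semigroup"
proof (clarsimp simp: semigroup_generator_def)
  fix x y assume xy: "(x, y) \<in> A"
  show "((\<lambda>h. (semigroup h x - x) /\<^sub>R h) \<longlongrightarrow> y) (at_right 0)"
  proof (rule tendstoI)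
    fix e :: real assume e: "e > 0"
    obtain y' z' w where y': "norm (y - y') < e / 4" "(y', z') \<in> A" "(z', w) \<in> A"
      using dense_domain_square[of "e / 4" y] e by auto
    define d where "d = e / 2 / (norm z' + 1)"
    have d: "d > 0" using e by (simp add: d_def add_nonneg_pos)
    have "dist ((semigroup t x - x) /\<^sub>R t) y < e" if t: "0 < t" "t < d" for t
    proof -
      have "(semigroup t x - x) /\<^sub>R t - y = (semigroup t x - x - t *\<^sub>R y) /\<^sub>R t"
        using t by (simp add: algebra_simps)
      also have "norm \<dots> = norm (semigroup t x - x - t *\<^sub>R y) / t"
        using t by (simp add: divide_inverse)
      also have "\<dots> \<le> 2 * norm (y - y') + t * norm z'"
        using semigroup_first_order[OF xy y'(2), of t] t by (simp add: pos_divide_le_eq mult.commute)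
      also have "t * norm z' \<le> d * (norm z' + 1)"
        using t d by (intro mult_mono) auto
      also have "\<dots> = e / 2" using d d_def by (metis nonzero_eq_divide_eq divide_eq_0_iff less_irrefl)
      finally show ?thesis using y'(1) by (simp add: dist_norm)
    qed
    then show "\<forall>\<^sub>F t in at_right 0. dist ((semigroup t x - x) /\<^sub>R t) y < e"
      using d eventually_at_right_field by blast
  qed
qed

end

section \<open>Generators of strongly continuous semigroups\<close>

lemma has_vector_derivative_right_quotient:
  fixes f :: "real \<Rightarrow> 'a::real_normed_vector"
  assumes "(f has_vector_derivative f') (at r within S)" and "{r..r + 1} \<subseteq> S"
  shows "((\<lambda>h. (f (r + h) - f r) /\<^sub>R h) \<longlongrightarrow> f') (at_right 0)"
proof -
  have "(f has_vector_derivative f') (at r within {r..r + 1})"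
    using assms by (rule has_vector_derivative_within_subset)
  then have "(f has_vector_derivative f') (at_right r)"
    by (simp add: at_within_Icc_at_right)
  then have "((\<lambda>y. (1 / norm (y - r)) *\<^sub>R (f y - (f r + (y - r) *\<^sub>R f'))) \<longlongrightarrow> 0) (at_right r)"
    by (simp add: has_vector_derivative_def has_derivative_within)
  then have "((\<lambda>h. (1 / norm h) *\<^sub>R (f (h + r) - (f r + h *\<^sub>R f'))) \<longlongrightarrow> 0) (at_right 0)"
    by (subst (asm) filterlim_at_right_to_0) simp
  moreover have "\<forall>\<^sub>F h in at_right 0. (1 / norm h) *\<^sub>R (f (h + r) - (f r + h *\<^sub>R f'))
      = (f (r + h) - f r) /\<^sub>R h - f'"
    using eventually_at_right_less[of "0::real"]
    by eventually_elim (simp add: add.commute scaleR_diff_right scaleR_add_right divide_inverse)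
  ultimately have "((\<lambda>h. (f (r + h) - f r) /\<^sub>R h - f') \<longlongrightarrow> 0) (at_right 0)"
    by (rule Lim_transform_eventually)
  then show ?thesis
    by (rule LIM_zero_cancel)
qed

text \<open>The set of t in [0, b] with f t <= f 0 is closed, and at a supremum smaller than b the
  negative right derivative would produce a larger element. Right derivatives are the natural input
  because generators are defined by right limits.\<close>

lemma nonincreasing_of_right_derivative_neg:
  fixes f :: "real \<Rightarrow> real"
  assumes cont: "continuous_on {0..} f"
    and deriv: "\<And>t. t \<ge> 0 \<Longrightarrow> ((\<lambda>h. (f (t + h) - f t) /\<^sub>R h) \<longlongrightarrow> d t) (at_right 0)"
    and neg: "\<And>t. t \<ge> 0 \<Longrightarrow> d t < 0"
    and "b \<ge> 0"
  shows "f b \<le> f 0"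
proof (rule ccontr)
  assume "\<not> f b \<le> f 0"
  define V where "V = {t \<in> {0..b}. f t \<le> f 0}"
  have "closed V"
    unfolding V_def by (rule continuous_on_closed_Collect_le)
      (auto intro: continuous_on_subset[OF cont] continuous_on_const)
  moreover have "0 \<in> V" using \<open>b \<ge> 0\<close> by (simp add: V_def)
  moreover have bdd: "bdd_above V" by (auto simp: V_def intro: bdd_aboveI[of _ b])
  ultimately have "Sup V \<in> V" by (intro closed_contains_Sup) auto
  define c where "c = Sup V"
  have c: "0 \<le> c" "f c \<le> f 0" "c < b"
    using \<open>Sup V \<in> V\<close> \<open>\<not> f b \<le> f 0\<close> by (auto simp: V_def c_def less_le)
  have "\<forall>\<^sub>F h in at_right 0. (f (c + h) - f c) /\<^sub>R h < 0"
    using order_tendstoD(2)[OF deriv neg] c(1) by blast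
  moreover have "\<forall>\<^sub>F h in at_right 0. h < b - c"
    using eventually_at_right_real[of 0 "b - c"] c(3) by (simp add: eventually_conj_iff)
  moreover have "\<forall>\<^sub>F h in at_right (0::real). 0 < h"
    by (rule eventually_at_right_less)
  ultimately have "\<forall>\<^sub>F h in at_right 0. 0 < h \<and> h < b - c \<and> (f (c + h) - f c) /\<^sub>R h < 0"
    by eventually_elim blast
  then obtain h where h: "0 < h" "h < b - c" "(f (c + h) - f c) /\<^sub>R h < 0"
    using eventually_happens' trivial_limit_at_right_real by blast
  then have "f (c + h) < f c"
    by (simp add: mult_less_0_iff)
  with h c have "c + h \<in> V" by (simp add: V_def)
  then have "c + h \<le> c" unfolding c_def by (rule cSup_upper[OF _ bdd])
  with h show False by simp
qed

lemma nonincreasing_of_right_derivative_nonpos: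
  fixes f :: "real \<Rightarrow> real"
  assumes cont: "continuous_on {0..} f"
    and deriv: "\<And>t. t \<ge> 0 \<Longrightarrow> ((\<lambda>h. (f (t + h) - f t) /\<^sub>R h) \<longlongrightarrow> d t) (at_right 0)"
    and nonpos: "\<And>t. t \<ge> 0 \<Longrightarrow> d t \<le> 0"
    and b: "b \<ge> 0"
  shows "f b \<le> f 0"
proof (rule field_le_epsilon)
  fix e :: real assume e: "e > 0"
  \<comment> \<open>Subtracting k t makes the derivative strictly negative. This k costs at most e
    at time b, and b + 1 avoids division by 0.\<close>
  define k where "k = e / (b + 1)"
  have k: "k > 0" using e b by (simp add: k_def)
  have "(\<lambda>t. f t - k * t) b \<le> (\<lambda>t. f t - k * t) 0"
  proof (rule nonincreasing_of_right_derivative_neg[where d = "\<lambda>t. d t - k"])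
    fix t :: real assume "t \<ge> 0"
    have "((\<lambda>h. (f (t + h) - f t) /\<^sub>R h - k) \<longlongrightarrow> d t - k) (at_right 0)"
      by (intro tendsto_intros deriv \<open>t \<ge> 0\<close>)
    moreover have "\<forall>\<^sub>F h in at_right 0. (f (t + h) - f t) /\<^sub>R h - k
        = (f (t + h) - k * (t + h) - (f t - k * t)) /\<^sub>R h"
      using eventually_at_right_less[of "0::real"] by eventually_elim (simp add: field_simps)
    ultimately show "((\<lambda>h. (f (t + h) - k * (t + h) - (f t - k * t)) /\<^sub>R h) \<longlongrightarrow> d t - k) (at_right 0)"
      by (rule Lim_transform_eventually)
    show "d t - k < 0"
      using nonpos[OF \<open>t \<ge> 0\<close>] k by simp
  qed (intro continuous_intros cont b)+
  moreover have "k * b \<le> e"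
    using e b by (simp add: k_def field_simps)
  ultimately show "f b \<le> f 0 + e" by simp
qed

lemma integral_right_derivative:
  fixes f :: "real \<Rightarrow> 'a::banach"
  assumes "continuous_on {0..} f" "r \<ge> 0"
  shows "((\<lambda>h. (integral {0..r + h} f - integral {0..r} f) /\<^sub>R h) \<longlongrightarrow> f r) (at_right 0)"
proof (rule has_vector_derivative_right_quotient)
  show "((\<lambda>u. integral {0..u} f) has_vector_derivative f r) (at r within {0..r + 1})"
    using assms by (intro integral_has_vector_derivative) (auto intro: continuous_on_subset)
qed (use assms in auto)

lemma semigroup_generator_iff:
  "(x, z) \<in> semigroup_generator T \<longleftrightarrow> ((\<lambda>h. (T h x - x) /\<^sub>R h) \<longlongrightarrow> z) (at_right 0)"
  by (simp add: semigroup_generator_def)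

section \<open>Generators: means of orbits, density, contractivity\<close>

locale C0 =
  fixes T :: "real \<Rightarrow> 'a \<Rightarrow> 'a::complex_hilbert_space"
  assumes C0: "C0_semigroup T"
begin

lemma bounded_linear: "t \<ge> 0 \<Longrightarrow> bounded_linear (T t)"
  and T_0: "T 0 x = x"
  and T_plus: "s \<ge> 0 \<Longrightarrow> t \<ge> 0 \<Longrightarrow> T (s + t) x = T s (T t x)"
  and continuous: "continuous_on {0..} (\<lambda>t. T t x)"
  using C0 by (simp_all add: C0_semigroup_def)

lemma T_add: "t \<ge> 0 \<Longrightarrow> T t (x + y) = T t x + T t y"
  and T_scaleC: "t \<ge> 0 \<Longrightarrow> T t (c *\<^sub>C x) = c *\<^sub>C T t x"
  using C0 by (simp_all add: C0_semigroup_def clinear_add clinear_scaleC)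

lemma T_diff: "t \<ge> 0 \<Longrightarrow> T t (x - y) = T t x - T t y"
  using T_add[of t "x - y" y] by simp

lemma T_scaleR: "t \<ge> 0 \<Longrightarrow> T t (r *\<^sub>R x) = r *\<^sub>R T t x"
  by (metis T_scaleC scaleC_of_real)

lemma T_commute: "s \<ge> 0 \<Longrightarrow> t \<ge> 0 \<Longrightarrow> T s (T t x) = T t (T s x)"
  by (metis T_plus add.commute)

abbreviation "G \<equiv> semigroup_generator T"

lemma generator_cong:
  assumes "((\<lambda>h. q h) \<longlongrightarrow> z) (at_right 0)" and "\<And>h. h > 0 \<Longrightarrow> q h = (T h x - x) /\<^sub>R h"
  shows "(x, z) \<in> G"
  unfolding semigroup_generator_iff
  by (rule Lim_transform_eventually[OF assms(1) eventually_mono[OF eventually_at_right_less assms(2)]])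

lemma subspace_generator: "complex_vector.subspace G"
proof (rule operator_subspaceI)
  have "T h 0 = 0" if "h \<ge> 0" for h
    using T_diff[OF that, of 0 0] by simp
  then show "(0, 0) \<in> G"
    by (intro generator_cong[where q = "\<lambda>h. 0", OF tendsto_const]) simp
  show "(x + x', z + z') \<in> G" if "(x, z) \<in> G" "(x', z') \<in> G" for x x' z z'
    using tendsto_add[OF that[unfolded semigroup_generator_iff]]
    by (rule generator_cong) (simp add: T_add algebra_simps)
  show "(c *\<^sub>C x, c *\<^sub>C z) \<in> G" if "(x, z) \<in> G" for c x z
    using tendsto_scaleC[OF that[unfolded semigroup_generator_iff]]
    by (rule generator_cong) (simp add: T_scaleC scaleC_scaleR_commute scaleC_diff_right)
qed

lemma single_valued_generator: "single_valued G"
  by (rule single_valuedI)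
    (auto simp: semigroup_generator_iff intro: tendsto_unique[OF trivial_limit_at_right_real])

lemma T_integral:
  assumes "t \<ge> 0" "h \<ge> 0"
  shows "T h (integral {0..t} (\<lambda>s. T s x)) = integral {0..t + h} (\<lambda>s. T s x) - integral {0..h} (\<lambda>s. T s x)"
proof -
  have integrable: "(\<lambda>s. T s x) integrable_on {0..r}" for r
    by (intro integrable_continuous_real continuous_on_subset[OF continuous]) auto
  have "T h (integral {0..t} (\<lambda>s. T s x)) = integral {0..t} (T h \<circ> (\<lambda>s. T s x))"
    using integral_linear[OF integrable bounded_linear[OF assms(2)]] by simp
  also have "\<dots> = integral {0..t} ((\<lambda>s. T s x) \<circ> (+) h)"
    using assms by (intro integral_cong) (simp add: T_plus)
  also have "\<dots> = integral {h..t + h} (\<lambda>s. T s x)"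
    by (simp add: integral_shift_Icc_real)
  finally show ?thesis
    using Henstock_Kurzweil_Integration.integral_combine[OF _ _ integrable, of h "t + h"] assms
    by (simp add: algebra_simps)
qed

text \<open>T h shifts the interval of integration to [h, t + h], so the difference quotient is the
  mean over [t, t + h] minus the mean over [0, h]; these tend to T t x and x.\<close>

lemma integral_in_generator:
  assumes "t \<ge> 0"
  shows "(integral {0..t} (\<lambda>s. T s x), T t x - x) \<in> G"
proof (rule generator_cong)
  let ?F = "\<lambda>r. integral {0..r} (\<lambda>s. T s x)"
  show "((\<lambda>h. (?F (t + h) - ?F t) /\<^sub>R h - (?F (0 + h) - ?F 0) /\<^sub>R h) \<longlongrightarrow> T t x - x) (at_right 0)"
    using integral_right_derivative[OF continuous assms, of x]
      integral_right_derivative[OF continuous order_refl, of x]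
    unfolding T_0 by (rule tendsto_diff)
  show "(?F (t + h) - ?F t) /\<^sub>R h - (?F (0 + h) - ?F 0) /\<^sub>R h = (T h (?F t) - ?F t) /\<^sub>R h" if "h > 0" for h
    using that assms by (simp add: T_integral algebra_simps)
qed

text \<open>The means of the orbit over [0, h] lie in the domain by
  \<open>integral_in_generator\<close> and tend to T 0 x = x.\<close>

lemma dense_domain_generator:
  assumes "e > 0"
  obtains w z where "(w, z) \<in> G" "norm (x - w) < e"
proof -
  have "((\<lambda>h. integral {0..h} (\<lambda>s. T s x) /\<^sub>R h) \<longlongrightarrow> x) (at_right 0)"
    using integral_right_derivative[OF continuous order_refl, of x] by (simp add: T_0)
  then have "\<forall>\<^sub>F h in at_right 0. dist (integral {0..h} (\<lambda>s. T s x) /\<^sub>R h) x < e"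
    using assms by (rule tendstoD)
  then have "\<forall>\<^sub>F h in at_right 0. 0 < h \<and> dist (integral {0..h} (\<lambda>s. T s x) /\<^sub>R h) x < e"
    using eventually_at_right_less[of "0::real"] by eventually_elim simp
  then obtain h where "0 < h" "dist (integral {0..h} (\<lambda>s. T s x) /\<^sub>R h) x < e"
    using eventually_happens' trivial_limit_at_right_real by blast
  then show ?thesis
    using that[OF operator_scaleR[OF subspace_generator integral_in_generator[of h x], of "inverse h"]]
    by (simp add: dist_norm norm_minus_commute)
qed

lemma generator_invariant:
  assumes "(x, z) \<in> G" "t \<ge> 0"
  shows "(T t x, T t z) \<in> G"
  using bounded_linear.tendsto[OF bounded_linear[OF assms(2)] assms(1)[unfolded semigroup_generator_iff]]
  by (rule generator_cong) (simp add: assms(2) T_scaleR T_diff T_commute)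

text \<open>The domain is invariant, so for x in it |T t x|^2 has the right derivative 2 Re <T t z,
  T t x> <= 0; the difference quotient is handled by |a|^2 - |b|^2 = Re <a - b, a + b>. Density of
  the domain extends the bound, each T t being bounded.\<close>

lemma contractive_if_dissipative:
  assumes diss: "\<And>x z. (x, z) \<in> G \<Longrightarrow> rip z x \<le> 0" and t: "t \<ge> 0"
  shows "norm (T t x) \<le> norm x"
proof -
  have on_domain: "norm (T t x) \<le> norm x" if xz: "(x, z) \<in> G" for x z
  proof (rule power2_le_imp_le)
    have "(\<lambda>t. (norm (T t x))\<^sup>2) t \<le> (\<lambda>t. (norm (T t x))\<^sup>2) 0"
    proof (rule nonincreasing_of_right_derivative_nonpos[where d = "\<lambda>t. rip (T t z) (T t x + T t x)"])
      show "continuous_on {0..} (\<lambda>t. (norm (T t x))\<^sup>2)"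
        by (intro continuous_intros continuous)
      fix s :: real assume s: "s \<ge> 0"
      have "(T s x, T s z) \<in> G"
        using xz s by (rule generator_invariant)
      then show "rip (T s z) (T s x + T s x) \<le> 0"
        using diss by (simp add: rip.add_right)
      have "((\<lambda>r. T r x) \<longlongrightarrow> T s x) (at s within {0..})"
        using continuous s by (simp add: continuous_on_def)
      then have "((\<lambda>r. T r x) \<longlongrightarrow> T s x) (at_right s)"
        by (rule tendsto_within_subset) (use s in auto)
      then have shift: "((\<lambda>h. T (s + h) x) \<longlongrightarrow> T s x) (at_right 0)"
        by (subst (asm) filterlim_at_right_to_0) (simp add: add.commute)
      have "((\<lambda>h. rip ((T h (T s x) - T s x) /\<^sub>R h) (T (s + h) x + T s x))
          \<longlongrightarrow> rip (T s z) (T s x + T s x)) (at_right 0)"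
        using \<open>(T s x, T s z) \<in> G\<close> unfolding semigroup_generator_iff
        by (intro rip.tendsto tendsto_intros shift)
      moreover have "\<forall>\<^sub>F h in at_right 0. rip ((T h (T s x) - T s x) /\<^sub>R h) (T (s + h) x + T s x)
          = ((norm (T (s + h) x))\<^sup>2 - (norm (T s x))\<^sup>2) /\<^sub>R h"
        using eventually_at_right_less[of "0::real"]
      proof eventually_elim
        case (elim h)
        then have "T h (T s x) = T (s + h) x"
          using s by (simp add: T_plus T_commute)
        then show ?case
          by (simp add: rip.scaleR_left rip.diff_left rip.add_right power2_norm_eq_rip right_diff_distrib
              rip_commute[of "T s x" "T (s + h) x"])
      qed
      ultimately show "((\<lambda>h. ((norm (T (s + h) x))\<^sup>2 - (norm (T s x))\<^sup>2) /\<^sub>R h)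
          \<longlongrightarrow> rip (T s z) (T s x + T s x)) (at_right 0)"
        by (rule Lim_transform_eventually)
    qed (rule t)
    then show "(norm (T t x))\<^sup>2 \<le> (norm x)\<^sup>2"
      by (simp add: T_0)
  qed simp
  have "\<exists>w z. (w, z) \<in> G \<and> norm (x - w) < 1 / 2 ^ n" for n
    using dense_domain_generator[of "1 / 2 ^ n" x] by (metis zero_less_divide_1_iff zero_less_numeral zero_less_power)
  then obtain w where w: "\<And>n. \<exists>z. (w n, z) \<in> G" "\<And>n. norm (x - w n) < 1 / 2 ^ n"
    by metis
  have "(\<lambda>n. x - w n) \<longlonglongrightarrow> 0"
    by (rule Lim_null_comparison[OF always_eventually LIMSEQ_divide_realpow_zero[of 2 1]])
      (use w(2) in \<open>auto intro: less_imp_le\<close>)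
  then have lim: "w \<longlonglongrightarrow> x"
    using tendsto_diff[OF tendsto_const[of x]] by fastforce
  have le: "norm (T t (w n)) \<le> norm (w n)" for n
    using w(1) on_domain by blast
  show ?thesis
    by (rule LIMSEQ_le[OF tendsto_norm[OF bounded_linear.tendsto[OF bounded_linear[OF t] lim]]
          tendsto_norm[OF lim]]) (simp add: le)
qed

lemma C0_rescaled: "C0_semigroup (\<lambda>t x. exp (- t) *\<^sub>R T t x)"
  unfolding C0_semigroup_def
proof (intro conjI allI impI)
  show "bounded_linear (\<lambda>x. exp (- t) *\<^sub>R T t x)" if "0 \<le> t" for t
    by (intro bounded_linear_compose[OF bounded_linear_scaleR_right] bounded_linear that)
  show "Vector_Spaces.linear scaleC scaleC (\<lambda>x. exp (- t) *\<^sub>R T t x)" if "0 \<le> t" for t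
    using that by (intro clinearI) (simp_all add: T_add T_scaleC scaleR_add_right scaleC_scaleR_commute)
  show "(\<lambda>x. exp (- 0) *\<^sub>R T 0 x) = id"
    by (auto simp: T_0)
  show "(\<lambda>x. exp (- (s + t)) *\<^sub>R T (s + t) x) = (\<lambda>x. exp (- s) *\<^sub>R T s x) \<circ> (\<lambda>x. exp (- t) *\<^sub>R T t x)"
    if "0 \<le> s" "0 \<le> t" for s t
    using that by (auto simp: T_plus T_scaleR exp_add exp_diff exp_minus divide_inverse)
  show "continuous_on {0..} (\<lambda>t. exp (- t) *\<^sub>R T t x)" for x
    by (intro continuous_intros continuous)
qed

text \<open>Rescaling by exp (- t) shifts the generator by - I, so that solving (I - G) w = y
  becomes a question about the rescaled semigroup. The quotient of T is exp h times the rescaled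
  quotient plus ((exp h - 1) / h) x.\<close>

lemma generator_of_rescaled:
  assumes "(x, z) \<in> semigroup_generator (\<lambda>t x. exp (- t) *\<^sub>R T t x)"
  shows "(x, z + x) \<in> G"
proof (rule generator_cong)
  have "((\<lambda>h. exp h) has_vector_derivative exp 0) (at (0::real) within UNIV)"
    using DERIV_exp[of "0::real"] unfolding has_real_derivative_iff_has_vector_derivative by simp
  from has_vector_derivative_right_quotient[OF this]
  have d: "((\<lambda>h. (exp h - 1) /\<^sub>R h) \<longlongrightarrow> (1::real)) (at_right 0)"
    by simp
  have e: "((\<lambda>h. exp h) \<longlongrightarrow> (1::real)) (at_right 0)"
    using tendsto_exp[OF tendsto_ident_at[of "0::real" "{0<..}"]] by simp
  show "((\<lambda>h. exp h *\<^sub>R ((exp (- h) *\<^sub>R T h x - x) /\<^sub>R h) + ((exp h - 1) /\<^sub>R h) *\<^sub>R x) \<longlongrightarrow> z + x) (at_right 0)"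
    using tendsto_add[OF tendsto_scaleR[OF e assms[unfolded semigroup_generator_iff]]
        tendsto_scaleR[OF d tendsto_const[of x]]] by simp
  show "exp h *\<^sub>R ((exp (- h) *\<^sub>R T h x - x) /\<^sub>R h) + ((exp h - 1) /\<^sub>R h) *\<^sub>R x = (T h x - x) /\<^sub>R h" for h
  proof -
    have "exp h *\<^sub>R ((exp (- h) *\<^sub>R T h x - x) /\<^sub>R h) = (exp h *\<^sub>R (exp (- h) *\<^sub>R T h x - x)) /\<^sub>R h"
      by (simp add: mult.commute)
    also have "exp h *\<^sub>R (exp (- h) *\<^sub>R T h x - x) = T h x - exp h *\<^sub>R x"
      by (simp add: scaleR_diff_right flip: exp_add)
    finally show ?thesis
      by (simp add: scaleR_diff_right scaleR_diff_left right_diff_distrib mult.commute)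
  qed
qed

end

lemma m_dissipative_generator:
  assumes "contraction_semigroup T"
  shows "m_dissipative (semigroup_generator T)"
proof -
  interpret C0 T
    using assms by unfold_locales (simp add: contraction_semigroup_def)
  have contr: "norm (T t x) \<le> norm x" if "t \<ge> 0" for t x
    using assms that by (simp add: contraction_semigroup_def)
  show ?thesis
  proof
    show "rip z x \<le> 0" if "(x, z) \<in> G" for x z
    proof (rule tendsto_upperbound)
      show "((\<lambda>h. rip ((T h x - x) /\<^sub>R h) x) \<longlongrightarrow> rip z x) (at_right 0)"
        using that unfolding semigroup_generator_iff by (intro rip.tendsto tendsto_const)
      have "rip ((T h x - x) /\<^sub>R h) x \<le> 0" if "h > 0" for h
      proof -
        have "rip (T h x) x \<le> norm x * norm x"
          using rip_le_norm[of "T h x" x] contr[of h x] that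
          by (meson less_imp_le mult_right_mono norm_ge_zero order_trans)
        then show ?thesis
          using that by (simp add: rip.scaleR_left rip.diff_left mult_le_0_iff power2_norm_eq_rip[symmetric] power2_eq_square)
      qed
      then show "\<forall>\<^sub>F h in at_right 0. rip ((T h x - x) /\<^sub>R h) x \<le> 0"
        by (rule eventually_mono[OF eventually_at_right_less])
    qed simp
    show "\<exists>x z. (x, z) \<in> G \<and> x - z = y" for y
    proof -
      interpret S: C0 "\<lambda>t x. exp (- t) *\<^sub>R T t x"
        by unfold_locales (rule C0_rescaled)
      \<comment> \<open>Integrating over [0, 1] instead of the half-line of the Laplace transform
        leaves the boundary term exp (-1) T 1 x - x; the fixed point makes it equal to - y.\<close>
      have "dist (y + exp (- 1) *\<^sub>R T 1 a) (y + exp (- 1) *\<^sub>R T 1 b) \<le> exp (- 1) * dist a b" for a b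
        using contr[of 1 "a - b"] by (simp add: dist_norm T_diff flip: scaleR_diff_right)
      then obtain x where x: "y + exp (- 1) *\<^sub>R T 1 x = x"
        using banach_fix_type[of "exp (- 1)" "\<lambda>x. y + exp (- 1) *\<^sub>R T 1 x"] by auto
      have "exp (- 1) *\<^sub>R T 1 x - x = - y"
        using arg_cong[OF x, of "\<lambda>v. v - y - x"] by simp
      with generator_of_rescaled[OF S.integral_in_generator[of 1 x]]
      have "(integral {0..1} (\<lambda>s. exp (- s) *\<^sub>R T s x), - y + integral {0..1} (\<lambda>s. exp (- s) *\<^sub>R T s x)) \<in> G"
        by simp
      then show ?thesis by (intro exI conjI) (assumption, simp)
    qed
  qed (rule subspace_generator single_valued_generator)+
qed

context m_dissipative
begin

text \<open>A dissipative operator cannot properly extend one for which I - A is onto. The generator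
  of the limit semigroup extends A and is dissipative; if (w, g) in A satisfies w - g = x - z,
  injectivity of I minus this generator forces x = w.\<close>

lemma generates: "generates_contraction_semigroup A"
  unfolding generates_contraction_semigroup_def
proof (intro exI conjI)
  show "contraction_semigroup semigroup"
    by (rule contraction_semigroup)
  interpret G: m_dissipative "semigroup_generator semigroup"
    by (rule m_dissipative_generator[OF contraction_semigroup])
  show "A = semigroup_generator semigroup"
  proof
    show "A \<subseteq> semigroup_generator semigroup" by (rule subset_generator)
    show "semigroup_generator semigroup \<subseteq> A"
    proof clarify
      fix x z assume xz: "(x, z) \<in> semigroup_generator semigroup"
      obtain w g where wg: "(w, g) \<in> A" "w - g = x - z"
        using range_id_minus by blast
      have "norm (x - w) \<le> norm (x - w - 1 *\<^sub>R (z - g))"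
        using subset_generator wg(1) by (intro G.norm_le_norm_diff G.diff xz) auto
      also have "x - w - 1 *\<^sub>R (z - g) = (x - z) - (w - g)" by simp
      finally have "x = w" using wg(2) by simp
      with wg show "(x, z) \<in> A" by simp
    qed
  qed
qed

end

lemma generates_contraction_semigroup_iff_m_dissipative:
  "generates_contraction_semigroup A \<longleftrightarrow> m_dissipative A"
  using m_dissipative_generator m_dissipative.generates
  by (auto simp: generates_contraction_semigroup_def)

lemma generates_contraction_semigroup_if_dissipative:
  assumes "generates_C0_semigroup A" and "\<And>x z. (x, z) \<in> A \<Longrightarrow> rip z x \<le> 0"
  shows "generates_contraction_semigroup A"
proof -
  obtain T where T: "C0_semigroup T" "A = semigroup_generator T"
    using assms(1) by (auto simp: generates_C0_semigroup_def)
  interpret C0 T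
    using T(1) by unfold_locales
  have "contraction_semigroup T"
    using contractive_if_dissipative assms(2) T by (simp add: contraction_semigroup_def)
  with T(2) show ?thesis
    by (auto simp: generates_contraction_semigroup_def)
qed

section \<open>System nodes and output feedback\<close>

lemma AB_iff: "(w, z) \<in> AB \<Sigma> \<longleftrightarrow> (\<exists>y. (w, (z, y)) \<in> \<Sigma>)"
  by (cases w) (auto simp: AB_def)

lemma system_node_closed_AB:
  fixes \<Sigma> :: "('u::complex_hilbert_space, 'x::complex_hilbert_space, 'y::complex_hilbert_space)
    system_operator"
  assumes sub: "complex_vector.subspace \<Sigma>" and clos: "closed \<Sigma>" and c: "0 < c" "0 \<le> C"
    and est: "\<And>x u z y. ((x, u), (z, y)) \<in> \<Sigma> \<Longrightarrow> c * (norm y)\<^sup>2 \<le> C * (norm u)\<^sup>2 - 2 * rip z x"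
  shows "closed (AB \<Sigma>)"
  unfolding closed_sequential_limits
proof (intro allI impI, elim conjE)
  fix p :: "nat \<Rightarrow> ('x \<times> 'u) \<times> 'x" and l
  assume "\<forall>n. p n \<in> AB \<Sigma>" and lim: "p \<longlonglongrightarrow> l"
  then have "\<forall>n. \<exists>y. (fst (p n), (snd (p n), y)) \<in> \<Sigma>"
    by (metis AB_iff prod.collapse)
  then obtain y where y: "\<And>n. (fst (p n), (snd (p n), y n)) \<in> \<Sigma>"
    by metis
  \<comment> \<open>Every component of the difference d is bounded by |d|: the input term
    contributes C, the term 2 Re <z, x> contributes 2, and c is divided off.\<close>
  define K where "K = sqrt ((C + 2) / c)"
  have K: "K > 0" using c by (simp add: K_def)
  have le: "dist (y m) (y n) \<le> K * dist (p m) (p n)" for m n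
  proof -
    define d where "d = p m - p n"
    have norms: "norm (fst (fst d)) \<le> norm d" "norm (snd (fst d)) \<le> norm d" "norm (snd d) \<le> norm d"
      by (metis norm_fst_le norm_snd_le order_trans prod.collapse)+
    have "(fst d, (snd d, y m - y n)) \<in> \<Sigma>"
      using operator_diff[OF sub y[of m] y[of n]] by (simp add: d_def)
    then have "((fst (fst d), snd (fst d)), (snd d, y m - y n)) \<in> \<Sigma>"
      by simp
    from est[OF this]
    have "c * (norm (y m - y n))\<^sup>2 \<le> C * (norm (snd (fst d)))\<^sup>2 - 2 * rip (snd d) (fst (fst d))" .
    also have "- rip (snd d) (fst (fst d)) \<le> norm (snd d) * norm (fst (fst d))"
      using abs_rip_le_norm[of "snd d" "fst (fst d)"] by linarith
    then have "C * (norm (snd (fst d)))\<^sup>2 - 2 * rip (snd d) (fst (fst d))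
        \<le> C * (norm (snd (fst d)))\<^sup>2 + 2 * (norm (snd d) * norm (fst (fst d)))" by simp
    also have "\<dots> \<le> C * (norm d)\<^sup>2 + 2 * (norm d * norm d)"
      using c(2) norms by (intro add_mono mult_left_mono mult_mono power_mono) auto
    also have "\<dots> = (C + 2) * (norm d)\<^sup>2"
      by (simp add: power2_eq_square algebra_simps)
    also have "\<dots> = c * (K * norm d)\<^sup>2"
      using c by (simp add: K_def power_mult_distrib)
    finally have "(norm (y m - y n))\<^sup>2 \<le> (K * norm d)\<^sup>2"
      using c by simp
    then show ?thesis
      unfolding dist_norm d_def[symmetric] by (rule power2_le_imp_le) (use K in simp)
  qed
  \<comment> \<open>The outputs converge since the estimate controls them by states, inputs and derivatives.\<close>
  have "Cauchy y"
    unfolding Cauchy_def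
  proof (intro allI impI)
    fix e :: real assume "e > 0"
    with K have "e / K > 0" by simp
    then obtain M where "\<forall>m\<ge>M. \<forall>n\<ge>M. dist (p m) (p n) < e / K"
      using LIMSEQ_imp_Cauchy[OF lim] unfolding Cauchy_def by blast
    then have "\<forall>m\<ge>M. \<forall>n\<ge>M. K * dist (p m) (p n) < e"
      using K by (simp add: pos_less_divide_eq mult.commute)
    then show "\<exists>M. \<forall>m\<ge>M. \<forall>n\<ge>M. dist (y m) (y n) < e"
      using le by (meson le_less_trans)
  qed
  then obtain r where r: "y \<longlonglongrightarrow> r"
    using Cauchy_convergent convergent_def by blast
  have "(\<lambda>n. (fst (p n), (snd (p n), y n))) \<longlonglongrightarrow> (fst l, (snd l, r))"
    by (intro tendsto_intros lim r)
  then have "(fst l, (snd l, r)) \<in> \<Sigma>"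
    by (rule closed_sequentially[OF clos y])
  then show "l \<in> AB \<Sigma>"
    by (metis AB_iff prod.collapse)
qed

lemma CD_iff: "(w, y) \<in> CD \<Sigma> \<longleftrightarrow> (\<exists>z. (w, (z, y)) \<in> \<Sigma>)"
  by (cases w) (auto simp: CD_def)

lemma CD_comp_iff: "(w, k) \<in> CD \<Sigma> O K \<longleftrightarrow> (\<exists>z y. (w, (z, y)) \<in> \<Sigma> \<and> (y, k) \<in> K)"
  unfolding relcomp_unfold by (auto simp: CD_iff)

lemma feedback_minus_iff: "(w, v) \<in> feedback_minus K \<Sigma> \<longleftrightarrow>
    (\<exists>x u z y k. w = (x, u) \<and> v = (x, u - k) \<and> ((x, u), (z, y)) \<in> \<Sigma> \<and> (y, k) \<in> K)"
  and feedback_plus_iff: "(w, v) \<in> feedback_plus K \<Sigma> \<longleftrightarrow>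
    (\<exists>x u z y k. w = (x, u) \<and> v = (x, u + k) \<and> ((x, u), (z, y)) \<in> \<Sigma> \<and> (y, k) \<in> K)"
  unfolding feedback_minus_def feedback_plus_def CD_comp_iff by blast+

lemma main_operator_iff: "(x, z) \<in> main_operator \<Sigma> \<longleftrightarrow> (\<exists>y. ((x, 0), (z, y)) \<in> \<Sigma>)"
  by (auto simp: main_operator_def AB_def)

lemma m_dissipative_main_operator:
  fixes \<Sigma> :: "('u::complex_hilbert_space, 'x::complex_hilbert_space, 'y::complex_hilbert_space)
    system_operator"
  assumes lin: "linear_operator \<Sigma>"
    and diss: "\<And>x z y. ((x, 0), (z, y)) \<in> \<Sigma> \<Longrightarrow> rip z x \<le> 0"
    and range: "\<And>h. \<exists>x z y. ((x, 0), (z, y)) \<in> \<Sigma> \<and> x - z = h"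
  shows "m_dissipative (main_operator \<Sigma>)"
proof
  have sub: "complex_vector.subspace \<Sigma>" and sv: "single_valued \<Sigma>"
    using lin by (simp_all add: linear_operator_def)
  show "complex_vector.subspace (main_operator \<Sigma>)"
  proof (rule operator_subspaceI)
    show "(0, 0) \<in> main_operator \<Sigma>"
      using operator_zero[OF sub] by (auto simp: main_operator_iff zero_prod_def)
    show "(x + x', z + z') \<in> main_operator \<Sigma>"
      if "(x, z) \<in> main_operator \<Sigma>" "(x', z') \<in> main_operator \<Sigma>" for x z x' z'
      using that operator_add[OF sub] by (fastforce simp: main_operator_iff)
    show "(a *\<^sub>C x, a *\<^sub>C z) \<in> main_operator \<Sigma>" if "(x, z) \<in> main_operator \<Sigma>" for a x z
      using that operator_scaleC[OF sub, of _ _ a] by (fastforce simp: main_operator_iff scaleC_prod_def)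
  qed
  show "single_valued (main_operator \<Sigma>)"
    using sv by (auto simp: main_operator_iff single_valued_def)
  show "rip z x \<le> 0" if "(x, z) \<in> main_operator \<Sigma>" for x z
    using that diss by (auto simp: main_operator_iff)
  show "\<exists>x z. (x, z) \<in> main_operator \<Sigma> \<and> x - z = h" for h
    using range[of h] by (auto simp: main_operator_iff)
qed

lemma generates_C0_if_contraction:
  "generates_contraction_semigroup A \<Longrightarrow> generates_C0_semigroup A"
  by (auto simp: generates_contraction_semigroup_def generates_C0_semigroup_def contraction_semigroup_def)

text \<open>With c = C = 1 the estimate is passivity; with c = 1 - k and C = 1 / (1 - k) it is what
  passivity becomes under a feedback of norm at most k < 1. The assumption \<open>solve\<close>
  gives the range condition for the main operator at u = 0 and a compatible state for every other
  input.\<close>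

lemma system_nodeI:
  fixes \<Sigma> :: "('u::complex_hilbert_space, 'x::complex_hilbert_space, 'y::complex_hilbert_space)
    system_operator"
  assumes lin: "linear_operator \<Sigma>" and clos: "closed \<Sigma>" and c: "0 < c" "0 \<le> C"
    and est: "\<And>x u z y. ((x, u), (z, y)) \<in> \<Sigma> \<Longrightarrow> c * (norm y)\<^sup>2 \<le> C * (norm u)\<^sup>2 - 2 * rip z x"
    and solve: "\<And>h u. \<exists>x z y. ((x, u), (z, y)) \<in> \<Sigma> \<and> x - z = h"
  shows "system_node \<Sigma>"
  unfolding system_node_def
proof (intro conjI allI)
  show "closed (AB \<Sigma>)"
    using lin by (intro system_node_closed_AB[OF _ clos c est]) (simp add: linear_operator_def)
  have "rip z x \<le> 0" if "((x, 0), (z, y)) \<in> \<Sigma>" for x z y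
  proof -
    have "0 \<le> c * (norm y)\<^sup>2" using c(1) by simp
    with est[OF that] show ?thesis by simp
  qed
  then have "m_dissipative (main_operator \<Sigma>)"
    using solve by (intro m_dissipative_main_operator lin)
  then show "generates_C0_semigroup (main_operator \<Sigma>)"
    using m_dissipative.generates generates_C0_if_contraction by blast
  show "\<exists>x. (x, u) \<in> Domain \<Sigma>" for u
    using solve[of u] by blast
qed (fact lin clos)+

text \<open>Along a trajectory |x|^2 has derivative 2 Re <x', x>, so integrating the pointwise
  inequality over [0, T] yields the energy balance.\<close>

lemma scattering_passiveI:
  fixes \<Sigma> :: "('u::complex_hilbert_space, 'x::complex_hilbert_space, 'y::complex_hilbert_space)
    system_operator"
  assumes est: "\<And>x u z y. ((x, u), (z, y)) \<in> \<Sigma> \<Longrightarrow> 2 * rip z x \<le> (norm u)\<^sup>2 - (norm y)\<^sup>2"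
  shows "scattering_passive \<Sigma>"
  unfolding scattering_passive_def
proof (intro allI impI)
  fix T :: real and u x y
  assume T: "T \<ge> 0" and "classical_trajectory \<Sigma> u x y"
  then obtain x' where u: "continuous_on {0..} u" and y: "continuous_on {0..} y"
    and x: "\<And>t. t \<ge> 0 \<Longrightarrow> (x has_vector_derivative x' t) (at t within {0..})"
    and \<Sigma>: "\<And>t. t \<ge> 0 \<Longrightarrow> ((x t, u t), (x' t, y t)) \<in> \<Sigma>"
    by (auto simp: classical_trajectory_def)
  have x_T: "(x has_vector_derivative x' t) (at t within {0..T})" if "t \<in> {0..T}" for t
    using x[of t] that by (auto intro: has_vector_derivative_within_subset)
  have deriv: "((\<lambda>t. rip (x t) (x t)) has_vector_derivative rip (x t) (x' t) + rip (x' t) (x t))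
      (at t within {0..T})" if "t \<in> {0..T}" for t
    using rip.has_vector_derivative[OF x_T[OF that] x_T[OF that]] .
  have FTC: "((\<lambda>t. rip (x t) (x' t) + rip (x' t) (x t)) has_integral rip (x T) (x T) - rip (x 0) (x 0)) {0..T}"
    using T deriv by (rule fundamental_theorem_of_calculus)
  have int_u: "(\<lambda>t. (norm (u t))\<^sup>2) integrable_on {0..T}" and int_y: "(\<lambda>t. (norm (y t))\<^sup>2) integrable_on {0..T}"
    by (intro integrable_continuous_real continuous_intros continuous_on_subset[OF u]
        continuous_on_subset[OF y]; auto)+
  have "rip (x T) (x T) - rip (x 0) (x 0) \<le> integral {0..T} (\<lambda>t. (norm (u t))\<^sup>2 - (norm (y t))\<^sup>2)"
  proof (rule has_integral_le[OF FTC integrable_integral])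
    show "(\<lambda>t. (norm (u t))\<^sup>2 - (norm (y t))\<^sup>2) integrable_on {0..T}"
      by (intro integrable_diff int_u int_y)
    show "rip (x t) (x' t) + rip (x' t) (x t) \<le> (norm (u t))\<^sup>2 - (norm (y t))\<^sup>2" if "t \<in> {0..T}" for t
      using est[OF \<Sigma>[of t]] that by (simp add: rip_commute[of "x t"])
  qed
  also have "\<dots> = integral {0..T} (\<lambda>t. (norm (u t))\<^sup>2) - integral {0..T} (\<lambda>t. (norm (y t))\<^sup>2)"
    by (rule integral_diff[OF int_u int_y])
  finally show "(norm (x T))\<^sup>2 + integral {0..T} (\<lambda>t. (norm (y t))\<^sup>2)
      \<le> (norm (x 0))\<^sup>2 + integral {0..T} (\<lambda>t. (norm (u t))\<^sup>2)"
    by (simp add: power2_norm_eq_rip)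
qed

section \<open>The external Cayley system transform and its feedback\<close>

abbreviation "Cay \<equiv> external_cayley_system_transform"

lemma scaleR_sqrt2_inverse: "v /\<^sub>R sqrt 2 /\<^sub>R sqrt 2 = v /\<^sub>R 2"
  for v :: "'a::real_vector"
  by (simp flip: inverse_mult_distrib)

text \<open>(u, y) arises from (e, f) by a rotation, so e and f can be recovered. In this form the
  transform is a preimage of the graph under a continuous linear map, which carries over linear
  structure and closedness.\<close>

lemma external_cayley_iff:
  fixes x z :: "'x::complex_hilbert_space" and u y :: "'u::complex_hilbert_space"
  shows "((x, u), (z, y)) \<in> Cay A \<longleftrightarrow>
    ((x, (u + y) /\<^sub>R sqrt 2), (z, (y - u) /\<^sub>R sqrt 2)) \<in> A"
proof
  have half: "(v + v) /\<^sub>R 2 = v" for v :: 'u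
    by (simp flip: scaleR_2)
  assume "((x, u), (z, y)) \<in> Cay A"
  then obtain e f where "u = (e - f) /\<^sub>R sqrt 2" "y = (e + f) /\<^sub>R sqrt 2" "((x, e), (z, f)) \<in> A"
    by (auto simp: external_cayley_system_transform_def)
  moreover from this have "u + y = (e + e) /\<^sub>R sqrt 2" "y - u = (f + f) /\<^sub>R sqrt 2"
    by (simp_all add: algebra_simps)
  ultimately show "((x, (u + y) /\<^sub>R sqrt 2), (z, (y - u) /\<^sub>R sqrt 2)) \<in> A"
    by (simp only: scaleR_sqrt2_inverse half)
next
  have half: "(v + v) /\<^sub>R 2 = v" for v :: 'u
    by (simp flip: scaleR_2)
  define e where "e = (u + y) /\<^sub>R sqrt 2"
  define f where "f = (y - u) /\<^sub>R sqrt 2"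
  have "e - f = (u + u) /\<^sub>R sqrt 2" "e + f = (y + y) /\<^sub>R sqrt 2"
    by (simp_all add: e_def f_def algebra_simps)
  then have "(e - f) /\<^sub>R sqrt 2 = u" "(e + f) /\<^sub>R sqrt 2 = y"
    by (simp_all only: scaleR_sqrt2_inverse half)
  moreover assume "((x, (u + y) /\<^sub>R sqrt 2), (z, (y - u) /\<^sub>R sqrt 2)) \<in> A"
  ultimately show "((x, u), (z, y)) \<in> Cay A"
    unfolding external_cayley_system_transform_def e_def[symmetric] f_def[symmetric] by blast
qed

text \<open>The relational product takes a value of S at v twice; single-valuedness makes the two
  agree.\<close>

lemma cayley_transform_iff:
  assumes "linear_operator S"
  shows "(y, u) \<in> cayley_transform S \<longleftrightarrow> (\<exists>v s. (v, s) \<in> S \<and> y = s + v \<and> u = s - v)"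
  using assms by (auto simp: cayley_transform_def linear_operator_def) (metis single_valuedD)

lemma accretive:
  assumes "m_dissipative (neg_operator S)" and "(v, s) \<in> S"
  shows "rip s v \<ge> 0"
proof -
  have "(v, - s) \<in> neg_operator S"
    using assms(2) by (auto simp: neg_operator_def)
  then show ?thesis
    using m_dissipative.dissipative[OF assms(1)] by (fastforce simp: rip.minus_left)
qed

locale ext_generator = m_dissipative Aext
  for Aext :: "('x1::complex_hilbert_space \<times> 'x2::complex_hilbert_space, 'x1 \<times> 'x2) operator"
begin

lemma cayley_passive:
  assumes "((x, u), (z, y)) \<in> Cay Aext"
  shows "2 * rip z x \<le> (norm u)\<^sup>2 - (norm y)\<^sup>2"
proof -
  have "rip z x + rip ((y - u) /\<^sub>R sqrt 2) ((u + y) /\<^sub>R sqrt 2) \<le> 0"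
    using dissipative[OF assms[unfolded external_cayley_iff]] by (simp add: rip_prod)
  also have "rip ((y - u) /\<^sub>R sqrt 2) ((u + y) /\<^sub>R sqrt 2)
      = inverse (sqrt 2) * (inverse (sqrt 2) * rip (y - u) (u + y))"
    by (simp only: rip.scaleR_left rip.scaleR_right real_scaleR_def)
  also have "\<dots> = rip (y - u) (u + y) / 2"
    by (simp add: mult.assoc[symmetric] flip: inverse_mult_distrib)
  also have "rip (y - u) (u + y) = (norm y)\<^sup>2 - (norm u)\<^sup>2"
    by (simp add: power2_norm_eq_rip rip.diff_left rip.add_right rip_commute[of y u])
  finally show ?thesis by (simp add: field_simps)
qed

lemma cayley_solve: "\<exists>x z y. ((x, u), (z, y)) \<in> Cay Aext \<and> x - z = h"
proof -
  obtain p q where pq: "(p, q) \<in> Aext" "p - q = (h, sqrt 2 *\<^sub>R u)"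
    using range_id_minus by blast
  define e where "e = snd p"
  define f where "f = snd q"
  have ef: "(e - f) /\<^sub>R sqrt 2 = u" "fst p - fst q = h"
    using pq(2) by (auto simp: prod_eq_iff e_def f_def)
  have "((fst p, e), (fst q, f)) \<in> Aext"
    using pq(1) by (simp add: e_def f_def)
  then have "((fst p, (e - f) /\<^sub>R sqrt 2), (fst q, (e + f) /\<^sub>R sqrt 2)) \<in> Cay Aext"
    unfolding external_cayley_system_transform_def by blast
  with ef show ?thesis by auto
qed

text \<open>The new inputs and outputs mix arguments and values of \<open>Aext\<close>, so
  single-valuedness has to be earned: passivity at x = 0, u = 0 forces y = 0, hence e = f = 0, and
  then z = 0 because \<open>Aext\<close> is single-valued.\<close>

lemma linear_operator_cayley: "linear_operator (Cay Aext)"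
proof -
  have sub: "complex_vector.subspace (Cay Aext)"
  proof (rule operator_subspaceI)
    show "(0, 0) \<in> Cay Aext"
      using operator_zero[OF subspace] by (simp add: zero_prod_def external_cayley_iff)
    show "(w + w', p + p') \<in> Cay Aext"
      if "(w, p) \<in> Cay Aext" "(w', p') \<in> Cay Aext" for w p w' p'
    proof -
      obtain x u z y x' u' z' y' where "w = (x, u)" "p = (z, y)" "w' = (x', u')" "p' = (z', y')"
        by fastforce
      with add[OF that[unfolded external_cayley_iff this]] show ?thesis
        by (simp add: external_cayley_iff scaleR_add_right scaleR_diff_right add_ac add_diff_eq diff_add_eq diff_diff_eq2 diff_diff_eq)
    qed
    show "(c *\<^sub>C w, c *\<^sub>C p) \<in> Cay Aext" if "(w, p) \<in> Cay Aext" for c w p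
    proof -
      obtain x u z y where "w = (x, u)" "p = (z, y)"
        by fastforce
      with scaleC[OF that[unfolded external_cayley_iff this], of c] show ?thesis
        by (simp add: external_cayley_iff scaleC_prod_def scaleC_scaleR_commute scaleC_add_right scaleC_diff_right)
    qed
  qed
  have "p = 0" if "(0, p) \<in> Cay Aext" for p
  proof -
    obtain z y where p: "p = (z, y)" by fastforce
    have in_Cay: "((0, 0), (z, y)) \<in> Cay Aext"
      using that by (simp add: p zero_prod_def)
    have "y = 0"
      using cayley_passive[OF in_Cay] by (simp add: rip.zero_right)
    with in_Cay have "((0, 0), (z, 0)) \<in> Aext"
      by (simp add: external_cayley_iff)
    moreover have "((0, 0), (0, 0)) \<in> Aext"
      using operator_zero[OF subspace] by (simp add: zero_prod_def)
    ultimately have "(z, 0) = (0, 0 :: 'x2)"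
      by (rule unique)
    with \<open>y = 0\<close> p show ?thesis by (simp add: zero_prod_def)
  qed
  with sub show ?thesis
    by (simp add: linear_operator_def single_valued_operatorI)
qed

lemma closed_cayley: "closed (Cay Aext)"
proof -
  have "Cay Aext = (\<lambda>p. ((fst (fst p), (snd (fst p) + snd (snd p)) /\<^sub>R sqrt 2),
      (fst (snd p), (snd (snd p) - snd (fst p)) /\<^sub>R sqrt 2))) -` Aext"
    by (auto simp: external_cayley_iff)
  also have "closed \<dots>"
    by (intro closed_vimage closed continuous_intros)
  finally show ?thesis .
qed

lemma system_node_cayley: "system_node (Cay Aext)"
  by (rule system_nodeI[OF linear_operator_cayley closed_cayley, of 1 1])
    (use cayley_passive cayley_solve in \<open>fastforce simp: algebra_simps\<close>)+

lemma cayley_unique: "((x, u), (z, y)) \<in> Cay Aext \<Longrightarrow> ((x, u), (z', y')) \<in> Cay Aext \<Longrightarrow> z' = z \<and> y' = y"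
  using linear_operator_cayley by (auto simp: linear_operator_def dest: single_valuedD)

text \<open>Since \<open>\<Sigma>\<close> is single-valued, its output in the definition of the feedback may be taken to be
  the given one.\<close>

lemma closed_loop_iff:
  "((x, v), (z, y)) \<in> (feedback_minus K (Cay Aext))\<inverse> O Cay Aext \<longleftrightarrow>
    (\<exists>k. (y, k) \<in> K \<and> ((x, v + k), (z, y)) \<in> Cay Aext)"
proof
  assume "((x, v), (z, y)) \<in> (feedback_minus K (Cay Aext))\<inverse> O Cay Aext"
  then obtain u k y' z' where "v = u - k" "((x, u), (z, y)) \<in> Cay Aext"
    "((x, u), (z', y')) \<in> Cay Aext" "(y', k) \<in> K"
    by (auto simp: feedback_minus_def CD_def)
  then show "\<exists>k. (y, k) \<in> K \<and> ((x, v + k), (z, y)) \<in> Cay Aext"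
    using cayley_unique by (intro exI[of _ k]) fastforce
next
  assume "\<exists>k. (y, k) \<in> K \<and> ((x, v + k), (z, y)) \<in> Cay Aext"
  then obtain k where k: "(y, k) \<in> K" "((x, v + k), (z, y)) \<in> Cay Aext" by blast
  then have "((x, v + k), (x, v + k - k)) \<in> feedback_minus K (Cay Aext)"
    unfolding feedback_minus_def CD_def by blast
  with k(2) show "((x, v), (z, y)) \<in> (feedback_minus K (Cay Aext))\<inverse> O Cay Aext"
    by auto
qed

text \<open>Zero input of the closed loop is \<open>u = K y\<close> for the original system, which means
  \<open>y = s + v\<close> and \<open>u = s - v\<close> for some \<open>(v, s)\<close> in \<open>S\<close>, that is, \<open>e = S f\<close> with \<open>e = \<surd>2 s\<close> and
  \<open>f = \<surd>2 v\<close>.\<close>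

lemma main_operator_closed_loop:
  assumes S: "linear_operator S"
  shows "main_operator ((feedback_minus (cayley_transform S) (Cay Aext))\<inverse> O Cay Aext) = A_S Aext S"
proof -
  have sub: "complex_vector.subspace S"
    using S by (simp add: linear_operator_def)
  have "(x, z) \<in> A_S Aext S \<longleftrightarrow>
      (\<exists>y k. (y, k) \<in> cayley_transform S \<and> ((x, k), (z, y)) \<in> Cay Aext)" for x z
  proof
    assume "(x, z) \<in> A_S Aext S"
    then obtain f s where fs: "(f, s) \<in> S" "((x, s), (z, f)) \<in> Aext"
      by (auto simp: A_S_def)
    from operator_scaleR[OF sub fs(1), of "inverse (sqrt 2)"]
    have "((s + f) /\<^sub>R sqrt 2, (s - f) /\<^sub>R sqrt 2) \<in> cayley_transform S"
      unfolding cayley_transform_iff[OF S] by (auto simp: scaleR_add_right scaleR_diff_right)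
    moreover have "((x, (s - f) /\<^sub>R sqrt 2), (z, (s + f) /\<^sub>R sqrt 2)) \<in> Cay Aext"
      unfolding external_cayley_system_transform_def using fs(2) by blast
    ultimately show "\<exists>y k. (y, k) \<in> cayley_transform S \<and> ((x, k), (z, y)) \<in> Cay Aext"
      by blast
  next
    assume "\<exists>y k. (y, k) \<in> cayley_transform S \<and> ((x, k), (z, y)) \<in> Cay Aext"
    then obtain v s where vs: "(v, s) \<in> S" "((x, s - v), (z, s + v)) \<in> Cay Aext"
      by (auto simp: cayley_transform_iff[OF S])
    then have "((x, 2 *\<^sub>R s /\<^sub>R sqrt 2), (z, 2 *\<^sub>R v /\<^sub>R sqrt 2)) \<in> Aext"
      by (simp add: external_cayley_iff scaleR_2)
    moreover have "(2 *\<^sub>R v /\<^sub>R sqrt 2, 2 *\<^sub>R s /\<^sub>R sqrt 2) \<in> S"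
      by (intro operator_scaleR sub vs(1))
    ultimately show "(x, z) \<in> A_S Aext S"
      unfolding A_S_def by blast
  qed
  then show ?thesis
    by (auto simp: main_operator_iff closed_loop_iff)
qed

text \<open>Admissibility makes the closed loop a system node, and its main operator, a C0 generator
  by definition, is \<open>A_S\<close>. Dissipativity of \<open>Aext\<close> bounds Re <z, x> by -
  Re <f, S f>, which accretivity of S makes nonpositive.\<close>

lemma generates_A_S:
  assumes S: "linear_operator S" "m_dissipative (neg_operator S)"
    and adm: "admissible_feedback (cayley_transform S) (Cay Aext)"
  shows "generates_contraction_semigroup (A_S Aext S)"
proof (rule generates_contraction_semigroup_if_dissipative)
  obtain \<Sigma>f where "system_node \<Sigma>f" "\<Sigma>f = (feedback_minus (cayley_transform S) (Cay Aext))\<inverse> O Cay Aext"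
    using adm by (auto simp: admissible_feedback_def Let_def)
  then show "generates_C0_semigroup (A_S Aext S)"
    unfolding system_node_def by (metis main_operator_closed_loop[OF S(1)])
  show "rip z x \<le> 0" if xz: "(x, z) \<in> A_S Aext S" for x z
  proof -
    obtain f s where fs: "(f, s) \<in> S" "((x, s), (z, f)) \<in> Aext"
      using xz by (auto simp: A_S_def)
    then have "rip z x + rip f s \<le> 0"
      using dissipative[OF fs(2)] by (simp add: rip_prod)
    with accretive[OF S(2) fs(1)] show ?thesis
      by (simp add: rip_commute)
  qed
qed

text \<open>Two solutions with the same h satisfy z - z' = x - x', so passivity of their difference
  reads 2 |x - x'|^2 <= |u - u'|^2 - |y - y'|^2. Hence the output is a nonexpansive function Y of
  the input, and u = v + F (Y u) is a fixed point problem with constant k.\<close>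

lemma closed_loop_solve:
  assumes k: "0 \<le> k" "k < 1"
    and contr: "\<And>a b. norm (F a - F b) \<le> k * norm (a - b)"
  shows "\<exists>x z y. ((x, v + F y), (z, y)) \<in> Cay Aext \<and> x - z = h"
proof -
  obtain Y where Y: "\<And>u. \<exists>x z. ((x, u), (z, Y u)) \<in> Cay Aext \<and> x - z = h"
    using cayley_solve[of _ h] by metis
  have "norm (Y a - Y b) \<le> norm (a - b)" for a b
  proof (rule power2_le_imp_le)
    obtain x z x' z' where xz: "((x, a), (z, Y a)) \<in> Cay Aext" "((x', b), (z', Y b)) \<in> Cay Aext"
      "x - z = h" "x' - z' = h"
      using Y by meson
    have "((x - x', a - b), (z - z', Y a - Y b)) \<in> Cay Aext"
      using operator_diff[OF _ xz(1,2)] linear_operator_cayley by (simp add: linear_operator_def)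
    moreover have "z - z' = x - x'"
      using xz(3,4) by (metis add_diff_cancel_left' diff_add_cancel diff_diff_eq2)
    ultimately have "2 * rip (x - x') (x - x') \<le> (norm (a - b))\<^sup>2 - (norm (Y a - Y b))\<^sup>2"
      using cayley_passive by metis
    then show "(norm (Y a - Y b))\<^sup>2 \<le> (norm (a - b))\<^sup>2"
      using zero_le_power2[of "norm (x - x')"] unfolding power2_norm_eq_rip by linarith
  qed simp
  then have "norm (F (Y a) - F (Y b)) \<le> k * norm (a - b)" for a b
    using contr order_trans mult_left_mono[OF _ k(1)] by meson
  then obtain u where u: "v + F (Y u) = u"
    using banach_fix_type[OF k, of "\<lambda>u. v + F (Y u)"] by (auto simp: dist_norm)
  obtain x z where "((x, u), (z, Y u)) \<in> Cay Aext" "x - z = h"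
    using Y by blast
  then show ?thesis
    by (intro exI[of _ x] exI[of _ z] exI[of _ "Y u"]) (simp add: u)
qed

text \<open>The third condition of admissibility dictates the closed loop, so it is taken as the
  definition and the rest is checked. With K as a function F, the closed loop feeds v + F y into the
  original system and observes the same y.\<close>

lemma admissible_strict_contraction:
  assumes K: "linear_operator K" "Domain K = UNIV" and k: "0 \<le> k" "k < 1"
    and contr: "\<And>y u. (y, u) \<in> K \<Longrightarrow> norm u \<le> k * norm y"
  shows "admissible_feedback K (Cay Aext)"
proof -
  have subK: "complex_vector.subspace K" and svK: "single_valued K"
    using K(1) by (simp_all add: linear_operator_def)
  have subC: "complex_vector.subspace (Cay Aext)" and svC: "single_valued (Cay Aext)"
    using linear_operator_cayley by (simp_all add: linear_operator_def)
  have "\<forall>y. \<exists>u. (y, u) \<in> K"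
    using K(2) by blast
  then obtain F where F_in: "\<And>y. (y, F y) \<in> K"
    by metis
  have F: "(y, u) \<in> K \<longleftrightarrow> u = F y" for y u
    using F_in svK by (auto dest: single_valuedD)
  have F_diff: "norm (F a - F b) \<le> k * norm (a - b)" for a b
    using contr[OF operator_diff[OF subK F_in F_in]] .
  define \<Sigma>f where "\<Sigma>f = (feedback_minus K (Cay Aext))\<inverse> O Cay Aext"
  have \<Sigma>f: "((x, v), (z, y)) \<in> \<Sigma>f \<longleftrightarrow> ((x, v + F y), (z, y)) \<in> Cay Aext" for x v z y
    by (simp add: \<Sigma>f_def closed_loop_iff F)
  have est: "(1 - k) * (norm y)\<^sup>2 \<le> 1 / (1 - k) * (norm v)\<^sup>2 - 2 * rip z x"
    if "((x, v), (z, y)) \<in> \<Sigma>f" for x v z y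
  proof -
    define a where "a = norm v"
    define b where "b = norm y"
    have "norm (v + F y) \<le> a + k * b"
      unfolding a_def b_def using contr[OF F_in] by (intro norm_triangle_mono order_refl)
    then have "(norm (v + F y))\<^sup>2 \<le> (a + k * b)\<^sup>2"
      by (rule power_mono) simp
    \<comment> \<open>A Young inequality weighted so that b^2 gets the coefficient k; subtracting it
      from the coefficient 1 in passivity leaves 1 - k.\<close>
    also have "\<dots> \<le> 1 / (1 - k) * a\<^sup>2 + k * b\<^sup>2"
    proof -
      have "1 / (1 - k) * a\<^sup>2 + k * b\<^sup>2 - (a + k * b)\<^sup>2 = k / (1 - k) * (a - (1 - k) * b)\<^sup>2"
        using k(2) by (simp add: field_simps power2_eq_square)
      moreover have "0 \<le> k / (1 - k) * (a - (1 - k) * b)\<^sup>2"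
        using k by (intro mult_nonneg_nonneg divide_nonneg_nonneg) simp_all
      ultimately show ?thesis by linarith
    qed
    finally show ?thesis
      using cayley_passive[OF that[unfolded \<Sigma>f]] unfolding a_def b_def left_diff_distrib by linarith
  qed
  have lin: "linear_operator \<Sigma>f"
  proof -
    have sub: "complex_vector.subspace \<Sigma>f"
    proof (rule operator_subspaceI)
      have F_add: "F (y + y') = F y + F y'" and F_scaleC: "F (c *\<^sub>C y) = c *\<^sub>C F y" for y y' c
        using operator_add[OF subK F_in F_in, of y y'] operator_scaleC[OF subK F_in, of c y]
        by (simp_all add: F)
      have "F 0 = 0"
        using operator_zero[OF subK] by (simp add: F)
      then show "(0, 0) \<in> \<Sigma>f"
        using operator_zero[OF subC] by (simp add: zero_prod_def \<Sigma>f)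
      show "(w + w', p + p') \<in> \<Sigma>f" if "(w, p) \<in> \<Sigma>f" "(w', p') \<in> \<Sigma>f" for w p w' p'
      proof -
        obtain x u z y x' u' z' y' where eq: "w = (x, u)" "p = (z, y)" "w' = (x', u')" "p' = (z', y')"
          by fastforce
        from operator_add[OF subC that[unfolded eq \<Sigma>f]] show ?thesis
          by (simp add: eq \<Sigma>f F_add add_ac)
      qed
      show "(c *\<^sub>C w, c *\<^sub>C p) \<in> \<Sigma>f" if "(w, p) \<in> \<Sigma>f" for c w p
      proof -
        obtain x u z y where eq: "w = (x, u)" "p = (z, y)"
          by fastforce
        from operator_scaleC[OF subC that[unfolded eq \<Sigma>f], of c] show ?thesis
          by (simp add: eq \<Sigma>f F_scaleC scaleC_prod_def scaleC_add_right)
      qed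
    qed
    have "p = 0" if "(0, p) \<in> \<Sigma>f" for p
    proof -
      obtain z y where p: "p = (z, y)" by fastforce
      have in_\<Sigma>f: "((0, 0), (z, y)) \<in> \<Sigma>f"
        using that by (simp add: p zero_prod_def)
      have "(1 - k) * (norm y)\<^sup>2 \<le> 0"
        using est[OF in_\<Sigma>f] by (simp add: rip.zero_right)
      then have "y = 0"
        using k by (simp add: mult_le_0_iff)
      then have "((0, 0), (z, 0)) \<in> Cay Aext"
        using in_\<Sigma>f operator_zero[OF subK] by (simp add: \<Sigma>f F[symmetric]) (simp add: F)
      then show ?thesis
        using cayley_unique[of 0 0 z 0 0 0] operator_zero[OF subC] \<open>y = 0\<close> p
        by (simp add: zero_prod_def)
    qed
    with sub show ?thesis
      by (simp add: linear_operator_def single_valued_operatorI)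
  qed
  have clos: "closed \<Sigma>f"
  proof -
    have cont: "continuous_on UNIV F"
      using F_diff k by (intro lipschitz_on_continuous_on[OF lipschitz_onI[of _ _ k]]) (simp_all add: dist_norm)
    have "\<Sigma>f = (\<lambda>p. ((fst (fst p), snd (fst p) + F (snd (snd p))), snd p)) -` Cay Aext"
      by (auto simp: \<Sigma>f)
    also have "closed \<dots>"
      by (intro closed_vimage closed_cayley continuous_intros continuous_on_compose2[OF cont]) simp
    finally show ?thesis .
  qed
  have node: "system_node \<Sigma>f"
    using k closed_loop_solve[OF k F_diff] by (intro system_nodeI[OF lin clos _ _ est]) (simp_all add: \<Sigma>f)
  have M: "(w, v) \<in> feedback_minus K (Cay Aext) \<longleftrightarrow>
      (\<exists>x u z y. w = (x, u) \<and> v = (x, u - F y) \<and> ((x, u), (z, y)) \<in> Cay Aext)" for w v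
    by (simp add: feedback_minus_iff F)
  have range: "Range (feedback_minus K (Cay Aext)) \<subseteq> Domain \<Sigma>f"
  proof
    fix v assume "v \<in> Range (feedback_minus K (Cay Aext))"
    then obtain x u z y where "v = (x, u - F y)" "((x, u), (z, y)) \<in> Cay Aext"
      by (auto simp: M)
    then have "(v, (z, y)) \<in> \<Sigma>f"
      by (simp add: \<Sigma>f)
    then show "v \<in> Domain \<Sigma>f" by blast
  qed
  have bound: "norm (v, q) \<le> (1 + k) * norm (w, p)"
    if wv: "(w, v) \<in> feedback_minus K (Cay Aext)" and wp: "(w, p) \<in> Cay Aext" and vq: "(v, q) \<in> \<Sigma>f"
    for w v p q
  proof -
    obtain x u z y where w: "w = (x, u)" "v = (x, u - F y)" "((x, u), (z, y)) \<in> Cay Aext"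
      using wv unfolding M by blast
    have p: "p = (z, y)"
      using svC wp w(1,3) by (auto dest: single_valuedD)
    have "((x, u - F y), (z, y)) \<in> \<Sigma>f"
      using w(3) by (simp add: \<Sigma>f)
    then have q: "q = (z, y)"
      using lin vq w(2) by (auto simp: linear_operator_def dest: single_valuedD)
    \<comment> \<open>The map M moves only the input, by F y, and |F y| <= k |y| is at most k times
      the graph norm.\<close>
    have "(v, q) = (w, p) - ((0, F y), 0)"
      by (simp add: w p q)
    then have "norm (v, q) \<le> norm (w, p) + norm (F y)"
      using norm_triangle_ineq4[of "(w, p)" "((0, F y), 0)"] by (simp add: norm_Pair)
    also have "norm (F y) \<le> k * norm y"
      by (rule contr[OF F_in])
    also have "norm y \<le> norm (w, p)"
      unfolding p by (rule order_trans[OF norm_snd_le norm_snd_le])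
    finally show ?thesis
      using k by (simp add: distrib_right mult_left_mono)
  qed
  have inverse: "(feedback_minus K (Cay Aext))\<inverse> = feedback_plus K \<Sigma>f"
  proof -
    have "(v, w) \<in> feedback_plus K \<Sigma>f \<longleftrightarrow>
        (\<exists>x u z y. v = (x, u) \<and> w = (x, u + F y) \<and> ((x, u + F y), (z, y)) \<in> Cay Aext)" for v w
      by (simp add: feedback_plus_iff F \<Sigma>f)
    then show ?thesis
      unfolding set_eq_iff split_paired_All converse_iff M
      by (fastforce intro: exI[of _ "_ - F _"])
  qed
  have bounded: "bounded_operator K"
    using K contr by (auto simp: bounded_operator_def)
  show ?thesis
    unfolding admissible_feedback_def Let_def
  proof (intro conjI exI[of _ \<Sigma>f])
    show "\<exists>c. \<forall>w v p q. (w, v) \<in> feedback_minus K (Cay Aext) \<and> (w, p) \<in> Cay Aext \<and> (v, q) \<in> \<Sigma>f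
        \<longrightarrow> norm (v, q) \<le> c * norm (w, p)"
      using bound by blast
  qed (fact bounded node range inverse \<Sigma>f_def)+
qed

end

text \<open>For y = s + v and u = s - v the loss |y|^2 - |u|^2 = 4 Re <s, v> is at least 4 \<delta>
  |v|^2, while |y| <= (1 + |c|) |v|. So at least the fraction r of |y|^2 is lost.\<close>

lemma cayley_transform_strict_contraction:
  fixes S :: "('a::complex_hilbert_space, 'a) operator"
  assumes S: "bounded_operator S" and \<delta>: "\<delta> > 0"
    and coercive: "\<And>x s. (x, s) \<in> S \<Longrightarrow> rip s x \<ge> \<delta> * (norm x)\<^sup>2"
  obtains k where "0 \<le> k" "k < 1" "\<And>y u. (y, u) \<in> cayley_transform S \<Longrightarrow> norm u \<le> k * norm y"
proof -
  have lin: "linear_operator S" using S by (simp add: bounded_operator_def)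
  obtain c where "\<forall>(x, s) \<in> S. norm s \<le> c * norm x"
    using S by (auto simp: bounded_operator_def)
  then have c: "\<And>x s. (x, s) \<in> S \<Longrightarrow> norm s \<le> c * norm x" by blast
  define r where "r = 4 * \<delta> / (1 + \<bar>c\<bar>)\<^sup>2"
  have r: "r > 0" using \<delta> by (simp add: r_def add_pos_nonneg)
  \<comment> \<open>The maximum keeps the radicand nonnegative without comparing r with 1.\<close>
  define k where "k = sqrt (max 0 (1 - r))"
  have "norm u \<le> k * norm y" if yu: "(y, u) \<in> cayley_transform S" for y u
  proof (rule power2_le_imp_le)
    obtain v s where vs: "(v, s) \<in> S" "y = s + v" "u = s - v"
      using yu by (auto simp: cayley_transform_iff[OF lin])
    have "norm y \<le> \<bar>c\<bar> * norm v + norm v"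
      unfolding vs(2) using c[OF vs(1)] mult_right_mono[OF abs_ge_self[of c] norm_ge_zero[of v]]
      by (intro norm_triangle_mono) auto
    then have "(norm y)\<^sup>2 \<le> ((1 + \<bar>c\<bar>) * norm v)\<^sup>2"
      by (intro power_mono) (simp_all add: distrib_right)
    then have "(norm y)\<^sup>2 / (1 + \<bar>c\<bar>)\<^sup>2 \<le> (norm v)\<^sup>2"
      by (simp add: power_mult_distrib divide_le_eq mult.commute add_pos_nonneg)
    from mult_left_mono[OF this, of "4 * \<delta>"]
    have "r * (norm y)\<^sup>2 \<le> 4 * (\<delta> * (norm v)\<^sup>2)"
      using \<delta> by (simp add: r_def)
    also have "\<dots> \<le> 4 * rip s v"
      using coercive[OF vs(1)] by simp
    also have "\<dots> = (norm y)\<^sup>2 - (norm u)\<^sup>2"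
      by (simp add: vs(2,3) norm_add_squared norm_diff_squared)
    finally have "(norm u)\<^sup>2 \<le> (1 - r) * (norm y)\<^sup>2"
      by (simp add: left_diff_distrib)
    also have "\<dots> \<le> max 0 (1 - r) * (norm y)\<^sup>2"
      by (intro mult_right_mono) auto
    also have "\<dots> = (k * norm y)\<^sup>2"
      by (simp add: k_def power_mult_distrib)
    finally show "(norm u)\<^sup>2 \<le> (k * norm y)\<^sup>2" .
  qed (simp add: k_def)
  moreover have "0 \<le> k" "k < 1"
    using r by (auto simp: k_def)
  ultimately show ?thesis using that by blast
qed

text \<open>If s + v = 0, then 0 <= Re <s, v> = - |v|^2, so S + I is injective; it is onto by the
  range condition for - S.\<close>

lemma linear_operator_cayley_transform:
  fixes S :: "('a::complex_hilbert_space, 'a) operator"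
  assumes S: "linear_operator S" and md: "m_dissipative (neg_operator S)"
  shows "linear_operator (cayley_transform S)" "Domain (cayley_transform S) = UNIV"
proof -
  have subS: "complex_vector.subspace S" and svS: "single_valued S"
    using S by (simp_all add: linear_operator_def)
  have sub: "complex_vector.subspace (cayley_transform S)"
  proof (rule operator_subspaceI)
    show "(0, 0) \<in> cayley_transform S"
      using operator_zero[OF subS] by (force simp: cayley_transform_iff[OF S])
    show "(y + y', u + u') \<in> cayley_transform S"
      if yu: "(y, u) \<in> cayley_transform S" "(y', u') \<in> cayley_transform S" for y u y' u'
    proof -
      obtain v s v' s' where "(v, s) \<in> S" "y = s + v" "u = s - v" "(v', s') \<in> S" "y' = s' + v'" "u' = s' - v'"
        using yu by (auto simp: cayley_transform_iff[OF S])
      then show ?thesis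
        unfolding cayley_transform_iff[OF S]
        by (intro exI[of _ "v + v'"] exI[of _ "s + s'"]) (simp add: operator_add[OF subS])
    qed
    show "(c *\<^sub>C y, c *\<^sub>C u) \<in> cayley_transform S" if yu: "(y, u) \<in> cayley_transform S" for c y u
    proof -
      obtain v s where "(v, s) \<in> S" "y = s + v" "u = s - v"
        using yu by (auto simp: cayley_transform_iff[OF S])
      then show ?thesis
        unfolding cayley_transform_iff[OF S]
        by (intro exI[of _ "c *\<^sub>C v"] exI[of _ "c *\<^sub>C s"])
          (simp add: operator_scaleC[OF subS] scaleC_add_right scaleC_diff_right)
    qed
  qed
  have "u = 0" if u: "(0, u) \<in> cayley_transform S" for u
  proof -
    obtain v s where vs: "(v, s) \<in> S" "0 = s + v" "u = s - v"
      using u by (auto simp: cayley_transform_iff[OF S])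
    then have s: "s = - v" by (simp add: eq_neg_iff_add_eq_0)
    then have "rip v v \<le> 0"
      using accretive[OF md vs(1)] by (simp add: rip.minus_left)
    then have "v = 0" by (simp flip: power2_norm_eq_rip)
    with s vs(3) show ?thesis by simp
  qed
  with sub show "linear_operator (cayley_transform S)"
    by (simp add: linear_operator_def single_valued_operatorI)
  have "y \<in> Domain (cayley_transform S)" for y
  proof -
    obtain x z where "(x, z) \<in> neg_operator S" "x - z = y"
      using m_dissipative.range_id_minus[OF md] by blast
    then have "(x, - z) \<in> S" "y = - z + x" by (auto simp: neg_operator_def)
    then have "(y, - z - x) \<in> cayley_transform S"
      unfolding cayley_transform_iff[OF S] by blast
    then show ?thesis by blast
  qed
  then show "Domain (cayley_transform S) = UNIV" by blast
qed

theorem theorem1p2: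
  fixes Aext :: "('x1::complex_hilbert_space \<times> 'x2::complex_hilbert_space, 'x1 \<times> 'x2) operator"
    and S :: "('x2, 'x2) operator"
  assumes "linear_operator Aext"
    and "generates_contraction_semigroup Aext"
    and "linear_operator S"
    and "generates_contraction_semigroup (neg_operator S)"
  shows "(system_node (external_cayley_system_transform Aext) \<and>
          scattering_passive (external_cayley_system_transform Aext)) \<and>
         (admissible_feedback (cayley_transform S) (external_cayley_system_transform Aext) \<longrightarrow>
            single_valued (A_S Aext S) \<and> generates_contraction_semigroup (A_S Aext S)) \<and>
         (bounded_operator S \<and>
          (\<exists>\<delta>>0. \<forall>(x, s) \<in> S. Re (cinner s x) \<ge> \<delta> * (norm x)\<^sup>2) \<longrightarrow>
            admissible_feedback (cayley_transform S) (external_cayley_system_transform Aext))"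
proof (intro conjI impI)
  interpret ext_generator Aext
    using assms(2) by (simp add: ext_generator_def generates_contraction_semigroup_iff_m_dissipative)
  have md: "m_dissipative (neg_operator S)"
    using assms(4) by (simp add: generates_contraction_semigroup_iff_m_dissipative)
  show "system_node (Cay Aext)" by (rule system_node_cayley)
  show "scattering_passive (Cay Aext)" using cayley_passive by (rule scattering_passiveI)
  show "generates_contraction_semigroup (A_S Aext S)"
    if "admissible_feedback (cayley_transform S) (Cay Aext)"
    using assms(3) md that by (rule generates_A_S)
  then show "single_valued (A_S Aext S)"
    if "admissible_feedback (cayley_transform S) (Cay Aext)"
    using that m_dissipative.single_valued generates_contraction_semigroup_iff_m_dissipative by blast
  show "admissible_feedback (cayley_transform S) (Cay Aext)"
    if coercive: "bounded_operator S \<and> (\<exists>\<delta>>0. \<forall>(x, s) \<in> S. Re (cinner s x) \<ge> \<delta> * (norm x)\<^sup>2)"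
  proof -
    obtain \<delta> where "\<delta> > 0" "\<And>x s. (x, s) \<in> S \<Longrightarrow> rip s x \<ge> \<delta> * (norm x)\<^sup>2"
      using coercive unfolding rip_def by blast
    with coercive obtain k where "0 \<le> k" "k < 1"
      "\<And>y u. (y, u) \<in> cayley_transform S \<Longrightarrow> norm u \<le> k * norm y"
      using cayley_transform_strict_contraction[of S \<delta>] by blast
    then show ?thesis
      by (rule admissible_strict_contraction[OF linear_operator_cayley_transform[OF assms(3) md]])
  qed
qed

end
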